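(* Let $G = G_1 *_H G_2$ be a hyperbolic group such that $G_1$, $G_2$ and $H$ are hyperbolic and the two inclusions $H\to G_1$ and $H\to G_2$ are quasi-isometric embeddings. If $H$ is malnormal in one of $G_1$ or $G_2$, then $H$ is quasiconvex in $G$.
   Context: Hyperbolic means hyperbolic in the sense of Gromov; groups carry word metrics with respect to finite generating sets. $G_1*_HG_2$ denotes the free product with amalgamation over $H$. A subgroup $H$ of a group $\Gamma$ is malnormal in $\Gamma$ if $gHg^{-1}\cap H = 1$ for all $g\in \Gamma\setminus H$. A subset $Z$ of a hyperbolic geodesic metric space is quasiconvex if there is $k$ such that any geodesic joining two points of $Z$ lies in the $k$-neighborhood of $Z$; a subgroup is quasiconvex in $G$ if it is a quasiconvex subset of the Cayley graph of $G$ with respect to a finite generating set. A map $f:(Y,d_Y)\to(Z,d_Z)$ is a quasi-isometric embedding if for some $K>0,\epsilon\ge 0$ one has $\frac1K d_Y(y_1,y_2)-\epsilon\le d_Z(f(y_1),f(y_2))\le K d_Y(y_1,y_2)+\epsilon$ for all $y_1,y_2$. *)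

theory Defs
  imports "HOL-Analysis.Analysis" "HOL-Algebra.Coset" "HOL-Algebra.Generated_Groups"
begin

section \<open>Coarse geometry of metric spaces\<close>

context Metric_space
begin

definition gromov_product :: "'a \<Rightarrow> 'a \<Rightarrow> 'a \<Rightarrow> real" where
  "gromov_product w x y = (d x w + d y w - d x y) / 2"

definition gromov_hyperbolic :: bool where
  "gromov_hyperbolic \<longleftrightarrow>
     (\<exists>\<delta>\<ge>0. \<forall>w\<in>M. \<forall>x\<in>M. \<forall>y\<in>M. \<forall>z\<in>M.
        gromov_product w x z \<ge> min (gromov_product w x y) (gromov_product w y z) - \<delta>)"

definition geodesic_between :: "'a \<Rightarrow> 'a \<Rightarrow> real \<Rightarrow> (real \<Rightarrow> 'a) \<Rightarrow> bool" where
  "geodesic_between x y L c \<longleftrightarrow>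
     0 \<le> L \<and> c ` {0..L} \<subseteq> M \<and> c 0 = x \<and> c L = y \<and>
     (\<forall>s\<in>{0..L}. \<forall>t\<in>{0..L}. d (c s) (c t) = \<bar>s - t\<bar>)"

definition quasiconvex :: "'a set \<Rightarrow> bool" where
  "quasiconvex Z \<longleftrightarrow> Z \<subseteq> M \<and>
     (\<exists>k. \<forall>x\<in>Z. \<forall>y\<in>Z. \<forall>L c. geodesic_between x y L c \<longrightarrow>
        (\<forall>t\<in>{0..L}. \<exists>z\<in>Z. d (c t) z \<le> k))"

end

definition quasi_isometric_embedding ::
  "'a set \<Rightarrow> ('a \<Rightarrow> 'a \<Rightarrow> real) \<Rightarrow> 'b set \<Rightarrow> ('b \<Rightarrow> 'b \<Rightarrow> real) \<Rightarrow> ('a \<Rightarrow> 'b) \<Rightarrow> bool" where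
  "quasi_isometric_embedding Y dY Z dZ f \<longleftrightarrow> f \<in> Y \<rightarrow> Z \<and>
     (\<exists>K>0. \<exists>\<epsilon>\<ge>0. \<forall>x\<in>Y. \<forall>y\<in>Y.
        1 / K * dY x y - \<epsilon> \<le> dZ (f x) (f y) \<and> dZ (f x) (f y) \<le> K * dY x y + \<epsilon>)"


section \<open>Geometric realization of a graph\<close>

text \<open>
  A graph has a vertex set \<open>V\<close> and a set \<open>E\<close> of two-element subsets of \<open>V\<close>. A point of its
  realization is given by its barycentric coordinates, a function on vertices that is supported
  on a single vertex or edge.
\<close>

definition cells :: "'a set \<Rightarrow> 'a set set \<Rightarrow> 'a set set" where
  "cells V E = (\<lambda>v. {v}) ` V \<union> E"

definition cell_points :: "'a set \<Rightarrow> ('a \<Rightarrow> real) set" where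
  "cell_points e = {p. (\<forall>x. 0 \<le> p x) \<and> (\<forall>x. x \<notin> e \<longrightarrow> p x = 0) \<and> (\<Sum>x\<in>e. p x) = 1}"

definition realization :: "'a set \<Rightarrow> 'a set set \<Rightarrow> ('a \<Rightarrow> real) set" where
  "realization V E = (\<Union>e\<in>cells V E. cell_points e)"

definition vertex :: "'a \<Rightarrow> 'a \<Rightarrow> real" where
  "vertex v = indicator {v}"

text \<open>
  On the points of one edge this is the metric that makes the edge isometric to the unit interval:
  the points \<open>(1 - s, s)\<close> and \<open>(1 - t, t)\<close> have distance \<open>\<bar>s - t\<bar>\<close>.
\<close>

definition cell_dist :: "('a \<Rightarrow> real) \<Rightarrow> ('a \<Rightarrow> real) \<Rightarrow> real" where
  "cell_dist p q = (\<Sum>x\<in>{x. p x \<noteq> 0 \<or> q x \<noteq> 0}. \<bar>p x - q x\<bar>) / 2"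

text \<open>
  Piecewise linear paths together with their length. The distance is the infimum of these lengths;
  it is set to \<open>0\<close> outside the realization because \<^locale>\<open>Metric_space\<close> asks for a function that is
  symmetric and nonnegative everywhere (likewise for the word metric below).
\<close>

inductive pl_path :: "'a set \<Rightarrow> 'a set set \<Rightarrow> ('a \<Rightarrow> real) \<Rightarrow> ('a \<Rightarrow> real) \<Rightarrow> real \<Rightarrow> bool"
  for V E where
  point: "p \<in> realization V E \<Longrightarrow> pl_path V E p p 0"
| extend: "\<lbrakk>pl_path V E p q l; e \<in> cells V E; q \<in> cell_points e; r \<in> cell_points e\<rbrakk>
           \<Longrightarrow> pl_path V E p r (l + cell_dist q r)"

definition path_dist :: "'a set \<Rightarrow> 'a set set \<Rightarrow> ('a \<Rightarrow> real) \<Rightarrow> ('a \<Rightarrow> real) \<Rightarrow> real" where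
  "path_dist V E p q =
     (if p \<in> realization V E \<and> q \<in> realization V E then Inf {l. pl_path V E p q l} else 0)"


section \<open>Finitely generated groups as metric spaces\<close>

definition finite_generating_set :: "('a, 'm) monoid_scheme \<Rightarrow> 'a set \<Rightarrow> bool" where
  "finite_generating_set G S \<longleftrightarrow> finite S \<and> S \<subseteq> carrier G \<and> generate G S = carrier G"

definition word_length :: "('a, 'm) monoid_scheme \<Rightarrow> 'a set \<Rightarrow> 'a \<Rightarrow> nat" where
  "word_length G S g =
     (LEAST n. \<exists>ws. length ws = n \<and> set ws \<subseteq> S \<union> m_inv G ` S \<and> foldr (mult G) ws (one G) = g)"

definition word_dist :: "('a, 'm) monoid_scheme \<Rightarrow> 'a set \<Rightarrow> 'a \<Rightarrow> 'a \<Rightarrow> real" where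
  "word_dist G S g h =
     (if g \<in> carrier G \<and> h \<in> carrier G
      then real (word_length G S (inv\<^bsub>G\<^esub> g \<otimes>\<^bsub>G\<^esub> h)) else 0)"

text \<open>
  The Cayley graph is taken as a simple graph: loops (from a trivial generator) are left out, and
  parallel edges (from an involution, or from two mutually inverse generators) are identified.
\<close>

definition cayley_edges :: "('a, 'm) monoid_scheme \<Rightarrow> 'a set \<Rightarrow> 'a set set" where
  "cayley_edges G S = {{g, g \<otimes>\<^bsub>G\<^esub> s} | g s. g \<in> carrier G \<and> s \<in> S \<and> s \<noteq> \<one>\<^bsub>G\<^esub>}"

definition cayley_graph :: "('a, 'm) monoid_scheme \<Rightarrow> 'a set \<Rightarrow> ('a \<Rightarrow> real) set" where
  "cayley_graph G S = realization (carrier G) (cayley_edges G S)"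

definition cayley_dist ::
  "('a, 'm) monoid_scheme \<Rightarrow> 'a set \<Rightarrow> ('a \<Rightarrow> real) \<Rightarrow> ('a \<Rightarrow> real) \<Rightarrow> real" where
  "cayley_dist G S = path_dist (carrier G) (cayley_edges G S)"

text \<open>
  For the groups to which they are applied, the following notions do not depend on the
  finite generating sets; each asks for one choice of them.
\<close>

definition hyperbolic_group :: "('a, 'm) monoid_scheme \<Rightarrow> bool" where
  "hyperbolic_group G \<longleftrightarrow> group G \<and>
     (\<exists>S. finite_generating_set G S \<and>
        Metric_space.gromov_hyperbolic (carrier G) (word_dist G S))"

definition qi_embedding_of_groups ::
  "('a, 'm) monoid_scheme \<Rightarrow> ('b, 'n) monoid_scheme \<Rightarrow> ('a \<Rightarrow> 'b) \<Rightarrow> bool" where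
  "qi_embedding_of_groups G K f \<longleftrightarrow>
     (\<exists>S T. finite_generating_set G S \<and> finite_generating_set K T \<and>
        quasi_isometric_embedding (carrier G) (word_dist G S) (carrier K) (word_dist K T) f)"

definition quasiconvex_subgroup :: "'a set \<Rightarrow> ('a, 'm) monoid_scheme \<Rightarrow> bool" where
  "quasiconvex_subgroup H G \<longleftrightarrow> subgroup H G \<and>
     (\<exists>S. finite_generating_set G S \<and>
        Metric_space.quasiconvex (cayley_graph G S) (cayley_dist G S) (vertex ` H))"

definition malnormal :: "'a set \<Rightarrow> ('a, 'm) monoid_scheme \<Rightarrow> bool" where
  "malnormal H G \<longleftrightarrow> subgroup H G \<and>
     (\<forall>g \<in> carrier G - H. (g <#\<^bsub>G\<^esub> H #>\<^bsub>G\<^esub> inv\<^bsub>G\<^esub> g) \<inter> H = {\<one>\<^bsub>G\<^esub>})"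


section \<open>Free products with amalgamation\<close>

text \<open>
  Words in the disjoint union of \<open>A\<close> and \<open>B\<close>, modulo the multiplication tables of \<open>A\<close>
  and \<open>B\<close> and the identification of \<open>i h\<close> with \<open>j h\<close> for \<open>h \<in> H\<close>.
\<close>

definition amalg_words :: "('a, 'm) monoid_scheme \<Rightarrow> ('b, 'n) monoid_scheme \<Rightarrow> ('a + 'b) list set"
  where "amalg_words A B = lists (carrier A <+> carrier B)"

inductive_set amalg_rel ::
  "('h, 'l) monoid_scheme \<Rightarrow> ('a, 'm) monoid_scheme \<Rightarrow> ('b, 'n) monoid_scheme \<Rightarrow>
   ('h \<Rightarrow> 'a) \<Rightarrow> ('h \<Rightarrow> 'b) \<Rightarrow> (('a + 'b) list \<times> ('a + 'b) list) set"
  for H A B i j where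
  rel_refl: "w \<in> amalg_words A B \<Longrightarrow> (w, w) \<in> amalg_rel H A B i j"
| rel_sym: "(v, w) \<in> amalg_rel H A B i j \<Longrightarrow> (w, v) \<in> amalg_rel H A B i j"
| rel_trans: "\<lbrakk>(u, v) \<in> amalg_rel H A B i j; (v, w) \<in> amalg_rel H A B i j\<rbrakk>
            \<Longrightarrow> (u, w) \<in> amalg_rel H A B i j"
| one_left: "\<lbrakk>u \<in> amalg_words A B; v \<in> amalg_words A B\<rbrakk>
            \<Longrightarrow> (u @ [Inl \<one>\<^bsub>A\<^esub>] @ v, u @ v) \<in> amalg_rel H A B i j"
| one_right: "\<lbrakk>u \<in> amalg_words A B; v \<in> amalg_words A B\<rbrakk>
            \<Longrightarrow> (u @ [Inr \<one>\<^bsub>B\<^esub>] @ v, u @ v) \<in> amalg_rel H A B i j"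
| mult_left: "\<lbrakk>u \<in> amalg_words A B; v \<in> amalg_words A B; x \<in> carrier A; y \<in> carrier A\<rbrakk>
            \<Longrightarrow> (u @ [Inl x, Inl y] @ v, u @ [Inl (x \<otimes>\<^bsub>A\<^esub> y)] @ v) \<in> amalg_rel H A B i j"
| mult_right: "\<lbrakk>u \<in> amalg_words A B; v \<in> amalg_words A B; x \<in> carrier B; y \<in> carrier B\<rbrakk>
            \<Longrightarrow> (u @ [Inr x, Inr y] @ v, u @ [Inr (x \<otimes>\<^bsub>B\<^esub> y)] @ v) \<in> amalg_rel H A B i j"
| glue: "\<lbrakk>u \<in> amalg_words A B; v \<in> amalg_words A B; h \<in> carrier H\<rbrakk>
            \<Longrightarrow> (u @ [Inl (i h)] @ v, u @ [Inr (j h)] @ v) \<in> amalg_rel H A B i j"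

definition amalgamated_product ::
  "('h, 'l) monoid_scheme \<Rightarrow> ('a, 'm) monoid_scheme \<Rightarrow> ('b, 'n) monoid_scheme \<Rightarrow>
   ('h \<Rightarrow> 'a) \<Rightarrow> ('h \<Rightarrow> 'b) \<Rightarrow> ('a + 'b) list set monoid" where
  "amalgamated_product H A B i j =
     \<lparr>carrier = amalg_words A B // amalg_rel H A B i j,
      mult = (\<lambda>X Y. amalg_rel H A B i j `` {u @ v | u v. u \<in> X \<and> v \<in> Y}),
      one = amalg_rel H A B i j `` {[]}\<rparr>"

text \<open>The canonical map from \<open>A\<close>; it agrees with the one from \<open>B\<close> on the amalgamated subgroup.\<close>

definition amalg_left ::
  "('h, 'l) monoid_scheme \<Rightarrow> ('a, 'm) monoid_scheme \<Rightarrow> ('b, 'n) monoid_scheme \<Rightarrow>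
   ('h \<Rightarrow> 'a) \<Rightarrow> ('h \<Rightarrow> 'b) \<Rightarrow> 'a \<Rightarrow> ('a + 'b) list set" where
  "amalg_left H A B i j a = amalg_rel H A B i j `` {[Inl a]}"


section \<open>Well-definedness: amalgams are groups, word metrics and Cayley graphs are metric spaces\<close>

lemma amalg_words_simps [simp]:
  "[] \<in> amalg_words A B"
  "u @ v \<in> amalg_words A B \<longleftrightarrow> u \<in> amalg_words A B \<and> v \<in> amalg_words A B"
  "Inl a # u \<in> amalg_words A B \<longleftrightarrow> a \<in> carrier A \<and> u \<in> amalg_words A B"
  "Inr b # u \<in> amalg_words A B \<longleftrightarrow> b \<in> carrier B \<and> u \<in> amalg_words A B"
  by (auto simp: amalg_words_def)

lemma amalg_rel_append:
  assumes "(v, w) \<in> amalg_rel H A B i j" "x \<in> amalg_words A B" "y \<in> amalg_words A B"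
  shows "(x @ v @ y, x @ w @ y) \<in> amalg_rel H A B i j"
  using assms(1)
proof induction
  case (rel_refl w)
  then show ?case using assms by (auto intro: amalg_rel.rel_refl)
next
  case (rel_sym v w)
  then show ?case by (auto intro: amalg_rel.rel_sym)
next
  case (rel_trans u v w)
  then show ?case by (blast intro: amalg_rel.rel_trans)
next
  case (one_left u v)
  then show ?case using amalg_rel.one_left[of "x @ u" A B "v @ y"] assms by simp
next
  case (one_right u v)
  then show ?case using amalg_rel.one_right[of "x @ u" A B "v @ y"] assms by simp
next
  case (mult_left u v a b)
  then show ?case using amalg_rel.mult_left[of "x @ u" A B "v @ y" a b] assms by simp
next
  case (mult_right u v a b)
  then show ?case using amalg_rel.mult_right[of "x @ u" A B "v @ y" a b] assms by simp
next
  case (glue u v h)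
  then show ?case using amalg_rel.glue[of "x @ u" A B "v @ y" h H i j] assms by simp
qed

locale amalgam = H: group H + A: group A + B: group B
  for H :: "('h, 'l) monoid_scheme" and A :: "('a, 'm) monoid_scheme"
    and B :: "('b, 'n) monoid_scheme" and i :: "'h \<Rightarrow> 'a" and j :: "'h \<Rightarrow> 'b" +
  assumes i: "i \<in> hom H A" and j: "j \<in> hom H B"
begin

abbreviation "W \<equiv> amalg_words A B"
abbreviation "R \<equiv> amalg_rel H A B i j"
abbreviation "P \<equiv> amalgamated_product H A B i j"

lemma amalg_rel_words: "(v, w) \<in> R \<Longrightarrow> v \<in> W \<and> w \<in> W"
  by (induction rule: amalg_rel.induct) (use i j in \<open>auto simp: hom_def\<close>)

lemma equiv_amalg_rel: "equiv W R"
  by (rule equivI)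
    (use amalg_rel_words in \<open>auto intro!: refl_onI symI transI intro: amalg_rel.rel_refl amalg_rel.rel_sym amalg_rel.rel_trans\<close>)

lemma amalg_rel_append2:
  assumes "(u, u') \<in> R" "(v, v') \<in> R"
  shows "(u @ v, u' @ v') \<in> R"
  using amalg_rel_append[OF assms(1), of "[]" v] amalg_rel_append[OF assms(2), of u' "[]"]
    amalg_rel_words[OF assms(1)] amalg_rel_words[OF assms(2)]
  by (auto intro: amalg_rel.rel_trans)

lemma amalg_class_eq: "u \<in> W \<Longrightarrow> v \<in> W \<Longrightarrow> R `` {u} = R `` {v} \<longleftrightarrow> (u, v) \<in> R"
  using equiv_amalg_rel eq_equiv_class_iff by fastforce

lemma amalg_mult:
  assumes "u \<in> W" "v \<in> W"
  shows "R `` {u} \<otimes>\<^bsub>P\<^esub> R `` {v} = R `` {u @ v}"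
proof -
  have "R `` {x @ y | x y. x \<in> R `` {u} \<and> y \<in> R `` {v}} = R `` {u @ v}" (is "?L = ?R")
  proof
    show "?L \<subseteq> ?R"
      by (auto intro: amalg_rel.rel_trans amalg_rel_append2)
    show "?R \<subseteq> ?L"
      using assms by (auto intro: amalg_rel.rel_refl)
  qed
  then show ?thesis by (simp add: amalgamated_product_def)
qed

lemma amalg_carrier: "carrier P = (\<lambda>w. R `` {w}) ` W"
  by (auto simp: amalgamated_product_def quotient_def)

lemma amalg_left_inverse: "w \<in> W \<Longrightarrow> \<exists>w'\<in>W. (w' @ w, []) \<in> R"
proof (induction w)
  case Nil
  then show ?case by (auto intro!: bexI[of _ "[]"] amalg_rel.rel_refl)
next
  case (Cons x w)
  then have w: "w \<in> W" by (cases x) auto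
  with Cons obtain w' where w': "w' \<in> W" "(w' @ w, []) \<in> R" by blast
  show ?case
  proof (cases x)
    case (Inl a)
    then have a: "a \<in> carrier A" using Cons by auto
    have "(w' @ [Inl (inv\<^bsub>A\<^esub> a), Inl a] @ w, w' @ [Inl \<one>\<^bsub>A\<^esub>] @ w) \<in> R"
      using amalg_rel.mult_left[OF w'(1) w, of "inv\<^bsub>A\<^esub> a" a] a by simp
    moreover have "(w' @ [Inl \<one>\<^bsub>A\<^esub>] @ w, w' @ w) \<in> R"
      using amalg_rel.one_left[OF w'(1) w] .
    ultimately have "((w' @ [Inl (inv\<^bsub>A\<^esub> a)]) @ x # w, []) \<in> R"
      using w'(2) Inl by (auto intro: amalg_rel.rel_trans)
    then show ?thesis using w'(1) a by (intro bexI[of _ "w' @ [Inl (inv\<^bsub>A\<^esub> a)]"]) auto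
  next
    case (Inr a)
    then have a: "a \<in> carrier B" using Cons by auto
    have "(w' @ [Inr (inv\<^bsub>B\<^esub> a), Inr a] @ w, w' @ [Inr \<one>\<^bsub>B\<^esub>] @ w) \<in> R"
      using amalg_rel.mult_right[OF w'(1) w, of "inv\<^bsub>B\<^esub> a" a] a by simp
    moreover have "(w' @ [Inr \<one>\<^bsub>B\<^esub>] @ w, w' @ w) \<in> R"
      using amalg_rel.one_right[OF w'(1) w] .
    ultimately have "((w' @ [Inr (inv\<^bsub>B\<^esub> a)]) @ x # w, []) \<in> R"
      using w'(2) Inr by (auto intro: amalg_rel.rel_trans)
    then show ?thesis using w'(1) a by (intro bexI[of _ "w' @ [Inr (inv\<^bsub>B\<^esub> a)]"]) auto
  qed
qed

lemma amalg_one: "\<one>\<^bsub>P\<^esub> = R `` {[]}"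
  by (simp add: amalgamated_product_def)

lemma group_amalgamated_product: "group P"
proof (rule groupI)
  show "\<exists>y\<in>carrier P. y \<otimes>\<^bsub>P\<^esub> x = \<one>\<^bsub>P\<^esub>" if x: "x \<in> carrier P" for x
  proof -
    obtain w where w: "w \<in> W" "x = R `` {w}" using x unfolding amalg_carrier by blast
    obtain w' where w': "w' \<in> W" "(w' @ w, []) \<in> R" using amalg_left_inverse[OF w(1)] by blast
    have "R `` {w'} \<otimes>\<^bsub>P\<^esub> x = R `` {w' @ w}" using w w' amalg_mult by simp
    also have "\<dots> = \<one>\<^bsub>P\<^esub>" using w w' by (simp add: amalg_one amalg_class_eq)
    finally show ?thesis using w' by (auto simp: amalg_carrier)
  qed
qed (auto simp: amalg_carrier amalg_mult amalg_one)

lemma amalg_left_hom: "amalg_left H A B i j \<in> hom A P"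
proof (rule homI)
  show "amalg_left H A B i j a \<in> carrier P" if "a \<in> carrier A" for a
    using that by (auto simp: amalg_left_def amalg_carrier)
  show "amalg_left H A B i j (a \<otimes>\<^bsub>A\<^esub> b)
      = amalg_left H A B i j a \<otimes>\<^bsub>P\<^esub> amalg_left H A B i j b"
    if "a \<in> carrier A" "b \<in> carrier A" for a b
    using amalg_rel.mult_left[of "[]" A B "[]" a b H i j] that
    by (simp add: amalg_left_def amalg_mult amalg_class_eq amalg_rel.rel_sym)
qed

lemma amalg_left_glue:
  "h \<in> carrier H \<Longrightarrow> amalg_left H A B i j (i h) = R `` {[Inr (j h)]}"
  using amalg_rel.glue[of "[]" A B "[]" h H i j] i j
  by (auto simp: amalg_left_def amalg_class_eq hom_def Pi_iff)

end

locale finitely_generated_group = group G for G :: "('a, 'm) monoid_scheme" (structure) +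
  fixes S assumes S: "finite_generating_set G S"
begin

abbreviation "T \<equiv> S \<union> m_inv G ` S"
abbreviation "eval_word ws \<equiv> foldr (mult G) ws \<one>"

lemma T_carrier: "T \<subseteq> carrier G"
  using S by (auto simp: finite_generating_set_def)

lemma eval_word_closed: "set ws \<subseteq> T \<Longrightarrow> eval_word ws \<in> carrier G"
  using T_carrier by (induction ws) auto

lemma eval_word_append:
  "set vs \<subseteq> T \<Longrightarrow> set ws \<subseteq> T \<Longrightarrow> eval_word (vs @ ws) = eval_word vs \<otimes> eval_word ws"
proof (induction vs)
  case (Cons x vs)
  then show ?case using eval_word_closed[of vs] eval_word_closed[of ws] T_carrier
    by (auto simp: m_assoc)
qed (simp add: eval_word_closed)

lemma mult_inv_cancel [simp]:
  assumes "x \<in> carrier G" "y \<in> carrier G"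
  shows "x \<otimes> (inv x \<otimes> y) = y" "inv x \<otimes> (x \<otimes> y) = y"
  using assms by (simp_all add: m_assoc[symmetric])

lemma T_inv: "t \<in> T \<Longrightarrow> inv t \<in> T"
  using T_carrier by auto

lemma eval_word_inv:
  "set ws \<subseteq> T \<Longrightarrow> eval_word (rev (map (m_inv G) ws)) = inv (eval_word ws)"
proof (induction ws)
  case (Cons x ws)
  have x: "x \<in> T" "inv x \<in> T" "x \<in> carrier G" using Cons.prems T_carrier T_inv by auto
  have "set (rev (map (m_inv G) ws)) \<subseteq> T" using Cons.prems T_inv by fastforce
  then have "eval_word (rev (map (m_inv G) (x # ws))) = inv (eval_word ws) \<otimes> inv x"
    using eval_word_append[of "rev (map (m_inv G) ws)" "[inv x]"] Cons x by simp
  then show ?case using x Cons.prems eval_word_closed[of ws] by (simp add: inv_mult_group)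
qed simp

lemma word_exists: "g \<in> carrier G \<Longrightarrow> \<exists>ws. set ws \<subseteq> T \<and> eval_word ws = g"
proof -
  assume "g \<in> carrier G"
  then have "g \<in> generate G S" using S by (auto simp: finite_generating_set_def)
  then show ?thesis
  proof induction
    case one
    then show ?case by (intro exI[of _ "[]"]) auto
  next
    case (incl h)
    then show ?case using T_carrier by (intro exI[of _ "[h]"]) auto
  next
    case (inv h)
    then show ?case using T_carrier by (intro exI[of _ "[inv h]"]) auto
  next
    case (eng g h)
    then obtain vs ws where "set vs \<subseteq> T" "eval_word vs = g" "set ws \<subseteq> T" "eval_word ws = h"
      by blast
    then show ?case using eval_word_append[of vs ws] by (intro exI[of _ "vs @ ws"]) simp
  qed
qed

lemma word_length_witness:
  assumes "g \<in> carrier G"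
  obtains ws where "length ws = word_length G S g" "set ws \<subseteq> T" "eval_word ws = g"
proof -
  obtain vs where "set vs \<subseteq> T" "eval_word vs = g" using word_exists[OF assms] by blast
  then have "\<exists>n ws. length ws = n \<and> set ws \<subseteq> T \<and> eval_word ws = g" by blast
  from LeastI_ex[OF this] show thesis using that unfolding word_length_def by blast
qed

lemma word_length_le: "set ws \<subseteq> T \<Longrightarrow> word_length G S (eval_word ws) \<le> length ws"
  unfolding word_length_def by (rule Least_le) blast

lemma word_length_mult:
  assumes "g \<in> carrier G" "h \<in> carrier G"
  shows "word_length G S (g \<otimes> h) \<le> word_length G S g + word_length G S h"
proof -
  obtain vs where vs: "length vs = word_length G S g" "set vs \<subseteq> T" "eval_word vs = g"
    using assms word_length_witness by blast
  obtain ws where ws: "length ws = word_length G S h" "set ws \<subseteq> T" "eval_word ws = h"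
    using assms word_length_witness by blast
  show ?thesis using word_length_le[of "vs @ ws"] eval_word_append[of vs ws] vs ws by simp
qed

lemma word_length_inv_le: 
  assumes "g \<in> carrier G" shows "word_length G S (inv g) \<le> word_length G S g"
proof -
  obtain vs where vs: "length vs = word_length G S g" "set vs \<subseteq> T" "eval_word vs = g"
    using assms word_length_witness by blast
  have "set (rev (map (m_inv G) vs)) \<subseteq> T" using vs T_inv by fastforce
  from word_length_le[OF this] show ?thesis using eval_word_inv[of vs] vs by simp
qed

lemma word_length_inv: "g \<in> carrier G \<Longrightarrow> word_length G S (inv g) = word_length G S g"
  using word_length_inv_le[of g] word_length_inv_le[of "inv g"] by simp

lemma word_length_eq_0:
  assumes "g \<in> carrier G"
  shows "word_length G S g = 0 \<longleftrightarrow> g = \<one>"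
proof -
  obtain ws where "length ws = word_length G S g" "set ws \<subseteq> T" "eval_word ws = g"
    using assms word_length_witness by blast
  then show ?thesis using word_length_le[of "[]"] by auto
qed

lemma word_length_dist_commute:
  "x \<in> carrier G \<Longrightarrow> y \<in> carrier G \<Longrightarrow> word_length G S (inv x \<otimes> y) = word_length G S (inv y \<otimes> x)"
  using word_length_inv[of "inv x \<otimes> y"] by (simp add: inv_mult_group)

lemma Metric_space_word_dist: "Metric_space (carrier G) (word_dist G S)"
proof
  show "0 \<le> word_dist G S x y" for x y
    by (simp add: word_dist_def)
  show "word_dist G S x y = word_dist G S y x" for x y
    using word_length_dist_commute by (simp add: word_dist_def)
  show "word_dist G S x y = 0 \<longleftrightarrow> x = y" if "x \<in> carrier G" "y \<in> carrier G" for x y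
  proof -
    have "inv x \<otimes> y = \<one> \<longleftrightarrow> x = y"
      using that by (metis inv_closed inv_equality inv_inv l_inv)
    then show ?thesis using that by (simp add: word_dist_def word_length_eq_0)
  qed
  show "word_dist G S x z \<le> word_dist G S x y + word_dist G S y z"
    if "x \<in> carrier G" "y \<in> carrier G" "z \<in> carrier G" for x y z
  proof -
    have "(inv x \<otimes> y) \<otimes> (inv y \<otimes> z) = inv x \<otimes> z"
      using that by (simp add: m_assoc)
    then show ?thesis
      using that word_length_mult[of "inv x \<otimes> y" "inv y \<otimes> z"] by (simp add: word_dist_def)
  qed
qed

end

lemma finite_pos_cell: "p \<in> cell_points e \<Longrightarrow> finite e \<and> e \<noteq> {}"
  by (cases "finite e") (auto simp: cell_points_def)

lemma finite_support_realization: "p \<in> realization V E \<Longrightarrow> finite {x. p x \<noteq> 0}"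
proof -
  assume "p \<in> realization V E"
  then obtain e where e: "p \<in> cell_points e" by (auto simp: realization_def)
  then have "{x. p x \<noteq> 0} \<subseteq> e" by (auto simp: cell_points_def)
  then show ?thesis by (rule finite_subset) (use finite_pos_cell[OF e] in simp)
qed

lemma cell_dist_eq:
  assumes "finite F" "{x. p x \<noteq> 0 \<or> q x \<noteq> 0} \<subseteq> F"
  shows "cell_dist p q = (\<Sum>x\<in>F. \<bar>p x - q x\<bar>) / 2"
  unfolding cell_dist_def using assms by (subst sum.mono_neutral_left[of F]) auto

lemma cell_dist_nonneg: "0 \<le> cell_dist p q"
  by (simp add: cell_dist_def sum_nonneg)

lemma cell_dist_commute: "cell_dist p q = cell_dist q p"
  by (simp add: cell_dist_def abs_minus_commute disj_commute)

lemma cell_dist_triangle: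
  assumes "finite {x. p x \<noteq> 0}" "finite {x. q x \<noteq> 0}" "finite {x. r x \<noteq> 0}"
  shows "cell_dist p r \<le> cell_dist p q + cell_dist q r"
proof -
  let ?F = "{x. p x \<noteq> 0} \<union> {x. q x \<noteq> 0} \<union> {x. r x \<noteq> 0}"
  have F: "finite ?F" using assms by simp
  have "(\<Sum>x\<in>?F. \<bar>p x - r x\<bar>) \<le> (\<Sum>x\<in>?F. \<bar>p x - q x\<bar> + \<bar>q x - r x\<bar>)"
    by (intro sum_mono) linarith
  then show ?thesis
    using F by (subst (1 2 3) cell_dist_eq[OF F]) (auto simp: sum.distrib)
qed

lemma pl_path_realization: "pl_path V E p q l \<Longrightarrow> p \<in> realization V E \<and> q \<in> realization V E"
  by (induction rule: pl_path.induct) (auto simp: realization_def)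

lemma pl_path_ge: "pl_path V E p q l \<Longrightarrow> cell_dist p q \<le> l"
proof (induction rule: pl_path.induct)
  case (point p)
  then show ?case by (simp add: cell_dist_def)
next
  case (extend p q l e r)
  have "r \<in> realization V E" using extend by (auto simp: realization_def)
  then have "cell_dist p r \<le> cell_dist p q + cell_dist q r"
    using pl_path_realization[OF extend.hyps(1)] finite_support_realization
    by (intro cell_dist_triangle) blast+
  then show ?case using extend.IH by simp
qed

lemma pl_path_trans: 
  assumes "pl_path V E q r m" "pl_path V E p q l" shows "pl_path V E p r (l + m)"
  using assms by (induction rule: pl_path.induct) (auto simp: add.assoc[symmetric] intro: pl_path.extend)

lemma pl_path_single:
  assumes "e \<in> cells V E" "q \<in> cell_points e" "r \<in> cell_points e"
  shows "pl_path V E q r (cell_dist q r)"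
proof -
  have "pl_path V E q q 0" by (rule pl_path.point) (use assms in \<open>auto simp: realization_def\<close>)
  from pl_path.extend[OF this assms] show ?thesis by simp
qed

lemma pl_path_sym: "pl_path V E p q l \<Longrightarrow> pl_path V E q p l"
proof (induction rule: pl_path.induct)
  case (extend p q l e r)
  from pl_path_trans[OF extend.IH pl_path_single[OF extend.hyps(2,4,3)]] show ?case
    by (simp add: cell_dist_commute add.commute)
qed (auto intro: pl_path.point)

lemma path_dist_le: "pl_path V E p q l \<Longrightarrow> path_dist V E p q \<le> l"
proof -
  assume l: "pl_path V E p q l"
  have "bdd_below {l. pl_path V E p q l}"
    by (rule bdd_belowI[of _ "cell_dist p q"]) (simp add: pl_path_ge)
  then have "Inf {l. pl_path V E p q l} \<le> l" using l by (intro cInf_lower) auto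
  then show ?thesis using pl_path_realization[OF l] by (simp add: path_dist_def)
qed

lemma path_dist_ge:
  assumes "pl_path V E p q l" "\<And>l. pl_path V E p q l \<Longrightarrow> c \<le> l"
  shows "c \<le> path_dist V E p q"
proof -
  have "c \<le> Inf {l. pl_path V E p q l}" using assms by (intro cInf_greatest) auto
  then show ?thesis using pl_path_realization[OF assms(1)] by (simp add: path_dist_def)
qed

lemma Metric_space_path_dist:
  assumes conn: "\<And>p q. p \<in> realization V E \<Longrightarrow> q \<in> realization V E \<Longrightarrow> \<exists>l. pl_path V E p q l"
  shows "Metric_space (realization V E) (path_dist V E)"
proof
  have ge: "cell_dist p q \<le> path_dist V E p q"
    if "p \<in> realization V E" "q \<in> realization V E" for p q
    using conn[OF that] path_dist_ge pl_path_ge by metis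
  show "0 \<le> path_dist V E p q" for p q
  proof (cases "p \<in> realization V E \<and> q \<in> realization V E")
    case True
    then show ?thesis using ge[of p q] cell_dist_nonneg[of p q] by linarith
  qed (auto simp: path_dist_def)
  show "path_dist V E p q = path_dist V E q p" for p q
  proof -
    have "{l. pl_path V E p q l} = {l. pl_path V E q p l}" using pl_path_sym by blast
    then show ?thesis by (simp add: path_dist_def)
  qed
  show "path_dist V E p q = 0 \<longleftrightarrow> p = q"
    if pq: "p \<in> realization V E" "q \<in> realization V E" for p q
  proof
    let ?F = "{x. p x \<noteq> 0} \<union> {x. q x \<noteq> 0}"
    assume "path_dist V E p q = 0"
    then have "cell_dist p q = 0" using ge[OF pq] cell_dist_nonneg[of p q] by simp
    moreover have F: "finite ?F" using pq finite_support_realization by blast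
    moreover have "cell_dist p q = (\<Sum>x\<in>?F. \<bar>p x - q x\<bar>) / 2" by (rule cell_dist_eq[OF F]) auto
    ultimately have "(\<Sum>x\<in>?F. \<bar>p x - q x\<bar>) = 0" by linarith
    then have *: "\<bar>p x - q x\<bar> = 0" if "x \<in> ?F" for x
      by (rule sum_nonneg_0[OF F abs_ge_zero _ that])
    show "p = q"
    proof
      show "p x = q x" for x using *[of x] by (cases "x \<in> ?F") auto
    qed
  next
    assume "p = q"
    then show "path_dist V E p q = 0"
      using ge[of p p] cell_dist_nonneg[of p p] path_dist_le[OF pl_path.point[OF pq(1)]] pq by simp
  qed
  show "path_dist V E p r \<le> path_dist V E p q + path_dist V E q r"
    if p: "p \<in> realization V E" and q: "q \<in> realization V E" and r: "r \<in> realization V E" for p q r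
  proof -
    have "path_dist V E p r - m \<le> l" if "pl_path V E p q l" "pl_path V E q r m" for l m
      using path_dist_le[OF pl_path_trans[OF that(2,1)]] by simp
    then have "path_dist V E p r - m \<le> path_dist V E p q" if "pl_path V E q r m" for m
      using conn[OF p q] path_dist_ge that by metis
    then have "path_dist V E p r - path_dist V E p q \<le> path_dist V E q r"
      using conn[OF q r] path_dist_ge by (metis diff_le_eq add.commute)
    then show ?thesis by simp
  qed
qed

lemma vertex_cell: "finite e \<Longrightarrow> v \<in> e \<Longrightarrow> vertex v \<in> cell_points e"
  by (auto simp: cell_points_def vertex_def indicator_def sum.If_cases)

lemma cell_dist_vertex: "u \<noteq> v \<Longrightarrow> cell_dist (vertex u) (vertex v) = 1"
  by (subst cell_dist_eq[of "{u, v}"]) (auto simp: vertex_def indicator_def)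

context finitely_generated_group
begin

lemma cayley_cell:
  "e \<in> cells (carrier G) (cayley_edges G S) \<Longrightarrow> finite e \<and> e \<noteq> {} \<and> e \<subseteq> carrier G"
  using T_carrier by (auto simp: cells_def cayley_edges_def)

lemma vertex_cayley_graph: "g \<in> carrier G \<Longrightarrow> vertex g \<in> cayley_graph G S"
  by (auto simp: cayley_graph_def realization_def cells_def intro!: bexI[of _ "{g}"] vertex_cell)

lemma cayley_edge:
  assumes g: "g \<in> carrier G" and t: "t \<in> T" "t \<noteq> \<one>"
  shows "{g, g \<otimes> t} \<in> cayley_edges G S"
proof (cases "t \<in> S")
  case True
  then show ?thesis using assms by (auto simp: cayley_edges_def)
next
  case False
  then obtain s where s: "s \<in> S" "t = inv s" using t by auto
  then have c: "s \<in> carrier G" "s \<noteq> \<one>" using T_carrier t by auto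
  have "(g \<otimes> t) \<otimes> s = g" using g s c by (simp add: m_assoc)
  then have "{g, g \<otimes> t} = {g \<otimes> t, (g \<otimes> t) \<otimes> s}" by auto
  then show ?thesis unfolding cayley_edges_def using g s c by blast
qed

lemma pl_path_word:
  assumes "g \<in> carrier G" "set ws \<subseteq> T"
  shows "\<exists>l\<le>real (length ws).
    pl_path (carrier G) (cayley_edges G S) (vertex g) (vertex (g \<otimes> eval_word ws)) l"
  using assms
proof (induction ws arbitrary: g)
  case Nil
  then show ?case using vertex_cayley_graph[of g]
    by (auto simp: cayley_graph_def intro: pl_path.point)
next
  case (Cons t ws)
  have t: "t \<in> T" "t \<in> carrier G" using Cons.prems T_carrier by auto
  have w: "eval_word ws \<in> carrier G" using Cons.prems eval_word_closed by simp
  obtain l where l: "l \<le> real (length ws)"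
    "pl_path (carrier G) (cayley_edges G S) (vertex (g \<otimes> t)) (vertex (g \<otimes> t \<otimes> eval_word ws)) l"
    using Cons.IH[of "g \<otimes> t"] Cons.prems t by auto
  have eq: "g \<otimes> t \<otimes> eval_word ws = g \<otimes> eval_word (t # ws)"
    using Cons.prems t w by (simp add: m_assoc)
  show ?case
  proof (cases "t = \<one>")
    case True
    then show ?thesis using l eq Cons.prems by (intro exI[of _ l]) auto
  next
    case False
    have e: "{g, g \<otimes> t} \<in> cells (carrier G) (cayley_edges G S)"
      using cayley_edge[OF Cons.prems(1) t(1) False] by (simp add: cells_def)
    have "g \<otimes> t \<noteq> g" using Cons.prems t False by simp
    then have "pl_path (carrier G) (cayley_edges G S) (vertex g) (vertex (g \<otimes> t)) 1"
      using pl_path_single[OF e vertex_cell vertex_cell, of g "g \<otimes> t"] 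
        cell_dist_vertex[of g "g \<otimes> t"] by simp
    from pl_path_trans[OF l(2) this] show ?thesis
      using l(1) eq by (intro exI[of _ "1 + l"]) auto
  qed
qed

lemma pl_path_vertices:
  assumes "g \<in> carrier G" "h \<in> carrier G"
  shows "\<exists>l\<le>word_dist G S g h.
    pl_path (carrier G) (cayley_edges G S) (vertex g) (vertex h) l"
proof -
  obtain ws where ws: "length ws = word_length G S (inv g \<otimes> h)" "set ws \<subseteq> T"
    "eval_word ws = inv g \<otimes> h"
    using word_length_witness[of "inv g \<otimes> h"] assms by auto
  have "g \<otimes> (inv g \<otimes> h) = h" using assms by simp
  moreover have "real (length ws) = word_dist G S g h"
    using ws(1) assms by (simp add: word_dist_def)
  ultimately show ?thesis using pl_path_word[OF assms(1) ws(2)] unfolding ws(3) by simp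
qed

lemma Metric_space_cayley_dist: "Metric_space (cayley_graph G S) (cayley_dist G S)"
  unfolding cayley_graph_def cayley_dist_def
proof (rule Metric_space_path_dist)
  let ?V = "carrier G" and ?E = "cayley_edges G S"
  have *: "\<exists>g l. g \<in> carrier G \<and> pl_path ?V ?E p (vertex g) l" if p: "p \<in> realization ?V ?E" for p
  proof -
    obtain e where e: "e \<in> cells ?V ?E" "p \<in> cell_points e" using p by (auto simp: realization_def)
    obtain g where "g \<in> e" using cayley_cell[OF e(1)] by blast
    then have "pl_path ?V ?E p (vertex g) (cell_dist p (vertex g))" "g \<in> carrier G"
      using pl_path_single[OF e vertex_cell] cayley_cell[OF e(1)] by auto
    then show ?thesis by blast
  qed
  show "\<exists>l. pl_path ?V ?E p q l" if pq: "p \<in> realization ?V ?E" "q \<in> realization ?V ?E" for p q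
  proof -
    obtain g l where g: "g \<in> carrier G" "pl_path ?V ?E p (vertex g) l" using *[OF pq(1)] by blast
    obtain h m where h: "h \<in> carrier G" "pl_path ?V ?E q (vertex h) m" using *[OF pq(2)] by blast
    obtain n where "pl_path ?V ?E (vertex g) (vertex h) n" using pl_path_vertices g h by blast
    from pl_path_trans[OF pl_path_trans[OF pl_path_sym[OF h(2)] this] g(2)] show ?thesis by blast
  qed
qed

lemma word_dist_generator:
  assumes "x \<in> carrier G" "g \<in> carrier G" "s \<in> S"
  shows "\<bar>word_dist G S x g - word_dist G S x (g \<otimes> s)\<bar> \<le> 1"
proof -
  have s: "s \<in> carrier G" using assms T_carrier by auto
  have "inv g \<otimes> (g \<otimes> s) = s" using assms s by simp
  moreover have "word_length G S s \<le> 1" using word_length_le[of "[s]"] assms s by simp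
  ultimately have "word_dist G S g (g \<otimes> s) \<le> 1" using assms s by (simp add: word_dist_def)
  then show ?thesis
    using Metric_space.triangle[OF Metric_space_word_dist, of x g "g \<otimes> s"] Metric_space.triangle[OF Metric_space_word_dist, of x "g \<otimes> s" g]
      Metric_space.commute[OF Metric_space_word_dist, of g "g \<otimes> s"] assms s by simp
qed

lemma pl_path_from_vertex_ge:
  assumes "pl_path (carrier G) (cayley_edges G S) p q l" "p = vertex g" "g \<in> carrier G"
  shows "(\<Sum>x\<in>{x. q x \<noteq> 0}. q x * word_dist G S g x) \<le> l"
  using assms
proof (induction rule: pl_path.induct)
  case (point p)
  have "{x. p x \<noteq> 0} = {g}" using point by (auto simp: vertex_def indicator_def)
  then show ?case
    using point Metric_space.zero[OF Metric_space_word_dist, of g g] by simp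
next
  case (extend p q l e r)
  let ?D = "word_dist G S g"
  have fin: "finite e" using cayley_cell extend by blast
  have sup: "{x. q x \<noteq> 0} \<subseteq> e" "{x. r x \<noteq> 0} \<subseteq> e" and sum1: "sum q e = 1" "sum r e = 1"
    using extend by (auto simp: cell_points_def)
  have sums: "(\<Sum>x\<in>{x. q x \<noteq> 0}. q x * ?D x) = (\<Sum>x\<in>e. q x * ?D x)"
    "(\<Sum>x\<in>{x. r x \<noteq> 0}. r x * ?D x) = (\<Sum>x\<in>e. r x * ?D x)"
    using fin sup by (auto intro!: sum.mono_neutral_left)
  have cd: "cell_dist q r = (\<Sum>x\<in>e. \<bar>q x - r x\<bar>) / 2"
    using fin sup by (intro cell_dist_eq) auto
  have "(\<Sum>x\<in>e. r x * ?D x) - (\<Sum>x\<in>e. q x * ?D x) \<le> cell_dist q r"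
  proof -
    consider v where "e = {v}"
      | v s where "v \<in> carrier G" "s \<in> S" "e = {v, v \<otimes> s}" "v \<noteq> v \<otimes> s"
      using extend(2) by (auto simp: cells_def cayley_edges_def)
    then show ?thesis
    proof cases
      case 1
      then show ?thesis using sum1 cd by simp
    next
      case 2
      have r: "r (v \<otimes> s) = 1 - r v" and q: "q (v \<otimes> s) = 1 - q v" using 2 sum1 by auto
      have "(\<Sum>x\<in>e. r x * ?D x) - (\<Sum>x\<in>e. q x * ?D x) = (r v - q v) * (?D v - ?D (v \<otimes> s))"
      proof -
        have "(\<Sum>x\<in>e. f x * ?D x) = f v * ?D v + f (v \<otimes> s) * ?D (v \<otimes> s)" for f :: "'a \<Rightarrow> real"
          using 2 by simp
        then show ?thesis unfolding r q by (simp add: r q algebra_simps)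
      qed
      also have "\<dots> \<le> \<bar>r v - q v\<bar> * \<bar>?D v - ?D (v \<otimes> s)\<bar>" by (metis abs_ge_self abs_mult)
      also have "\<dots> \<le> \<bar>r v - q v\<bar>"
        using word_dist_generator[OF extend.prems(2) 2(1,2)] by (simp add: mult_left_le)
      also have "\<dots> = cell_dist q r" using 2 r q cd by simp
      finally show ?thesis .
    qed
  qed
  then show ?case using extend.IH extend.prems sums by simp
qed

lemma cayley_dist_vertex:
  assumes "g \<in> carrier G" "h \<in> carrier G"
  shows "cayley_dist G S (vertex g) (vertex h) = word_dist G S g h"
proof (rule antisym)
  obtain l where l: "l \<le> word_dist G S g h"
    "pl_path (carrier G) (cayley_edges G S) (vertex g) (vertex h) l"
    using pl_path_vertices[OF assms] by blast
  show "cayley_dist G S (vertex g) (vertex h) \<le> word_dist G S g h"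
    using path_dist_le[OF l(2)] l(1) by (simp add: cayley_dist_def)
  have "{x. vertex h x \<noteq> 0} = {h}" by (auto simp: vertex_def indicator_def)
  then have "word_dist G S g h \<le> m"
    if "pl_path (carrier G) (cayley_edges G S) (vertex g) (vertex h) m" for m
    using pl_path_from_vertex_ge[OF that refl assms(1)] by (simp add: vertex_def)
  then show "word_dist G S g h \<le> cayley_dist G S (vertex g) (vertex h)"
    unfolding cayley_dist_def by (rule path_dist_ge[OF l(2)])
qed

end

end

theory Submission
  imports Defs
begin

text \<open>
  Let \<open>P\<close> be the amalgam of \<open>A\<close> and \<open>B\<close> over \<open>H\<close>, and let \<open>H\<close> be malnormal in \<open>A\<close>. It suffices to show that
  \<open>H\<close> is undistorted in \<open>P\<close>, because undistorted subgroups of hyperbolic groups are quasiconvex (the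
  Morse lemma, \<open>chain_connected_imp_interval_quasiconvex\<close>). As \<open>H\<close> is undistorted in \<open>B\<close>, it is
  enough to bound the distance in \<open>B\<close> of two elements of \<open>B\<close> linearly by their distance in \<open>P\<close>, and for
  this one needs a Lipschitz map from \<open>P\<close> to \<open>B\<close> that fixes \<open>B\<close>.

  Malnormality makes such a map possible. The subgroup \<open>H\<close> is quasiconvex in the hyperbolic group \<open>A\<close>,
  so nearest point projection from \<open>A\<close> to \<open>H\<close> is coarsely Lipschitz. If the projection of a coset
  \<open>x H \<noteq> H\<close> were large, then \<open>H\<close> and \<open>x H\<close> would stay close to each other for a long time, and by the
  pigeonhole principle \<open>x\<close> would conjugate a nontrivial element of \<open>H\<close> into \<open>H\<close>
  (\<open>malnormal_projection_bounded\<close>). Hence there is a map \<open>q\<close> from \<open>A\<close> to \<open>H\<close> that is the identity on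
  \<open>H\<close>, is moved a bounded amount by each right translation, and is constant on every coset
  \<open>x H \<noteq> H\<close> (\<open>malnormal_coarse_retraction\<close>).

  Now write an element of \<open>P\<close> as a reduced word \<open>b a \<dots>\<close> with \<open>b \<in> B\<close> and \<open>a \<in> A - H\<close>, and send it to
  \<open>b (q a)\<close>. What follows \<open>a\<close> does not matter. That is consistent, because \<open>a\<close> is determined up to
  its coset \<open>a H\<close>, on which \<open>q\<close> is constant. Right multiplication by an element of \<open>A\<close> or
  \<open>B\<close> changes the end of the word. It affects the image only if the word is so short that its end
  is \<open>b\<close> or \<open>a\<close>, and then the image moves by a bounded amount. So the map is Lipschitz
  (\<open>malnormal_left_undistorted\<close>). To have reduced words at hand, the group \<open>P\<close> is made to act from
  the right on the set of normal forms.
\<close>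

section \<open>Quasiconvex subsets of discrete hyperbolic spaces\<close>

text \<open>
  A quantity that is bounded by a logarithm of a linear function of itself is bounded. This is the
  point where exponential divergence beats linear length.
\<close>

lemma linear_bound_of_log_bound:
  fixes \<alpha> \<beta> \<gamma> \<delta> :: real
  assumes "0 \<le> \<alpha>" "0 \<le> \<delta>"
  obtains B where "0 \<le> B" "\<And>R. (\<And>m. \<alpha> * R + \<beta> \<le> 2 ^ m \<Longrightarrow> R \<le> \<gamma> + real m * \<delta>) \<Longrightarrow> R \<le> B"
proof -
  have "(\<lambda>m. (\<alpha> * (\<gamma> + (real m + 1) * \<delta>) + \<beta>) / 2 ^ m) \<longlonglongrightarrow> 0"
  proof -
    have "(\<lambda>m. (\<alpha> * (\<gamma> + \<delta>) + \<beta>) * (1 / 2) ^ m + \<alpha> * \<delta> * (real m * (1 / 2) ^ m)) \<longlonglongrightarrow>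
        (\<alpha> * (\<gamma> + \<delta>) + \<beta>) * 0 + \<alpha> * \<delta> * 0"
      by (intro tendsto_intros powser_times_n_limit_0) auto
    then show ?thesis by (simp add: field_simps power_divide)
  qed
  then have "\<forall>\<^sub>F m in sequentially. (\<alpha> * (\<gamma> + (real m + 1) * \<delta>) + \<beta>) / 2 ^ m < 1"
    by (rule order_tendstoD) simp
  then obtain m0 where m0: "\<alpha> * (\<gamma> + (real m + 1) * \<delta>) + \<beta> < 2 ^ m" if "m \<ge> m0" for m
    by (auto simp: eventually_sequentially)
  show thesis
  proof
    show "0 \<le> max 0 (\<gamma> + real m0 * \<delta>)" by simp
    show "R \<le> max 0 (\<gamma> + real m0 * \<delta>)"
      if R: "\<And>m. \<alpha> * R + \<beta> \<le> 2 ^ m \<Longrightarrow> R \<le> \<gamma> + real m * \<delta>" for R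
    proof -
      have ex: "\<exists>m. \<alpha> * R + \<beta> \<le> 2 ^ m"
        using real_arch_pow[of 2 "\<alpha> * R + \<beta>"] by (auto intro: less_imp_le)
      define m where "m = (LEAST m. \<alpha> * R + \<beta> \<le> 2 ^ m)"
      have m: "\<alpha> * R + \<beta> \<le> 2 ^ m" unfolding m_def by (rule LeastI_ex[OF ex])
      have "m \<le> m0"
      proof (rule ccontr)
        assume "\<not> m \<le> m0"
        then obtain m' where m': "m = Suc m'" "m0 \<le> m'" by (cases m) auto
        have "2 ^ m' < \<alpha> * R + \<beta>"
          using not_less_Least[of m' "\<lambda>m. \<alpha> * R + \<beta> \<le> 2 ^ m"] m' unfolding m_def by auto
        also have "\<dots> \<le> \<alpha> * (\<gamma> + (real m' + 1) * \<delta>) + \<beta>"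
          using R[OF m] assms(1) m'(1) by (auto intro!: mult_left_mono simp: add.commute)
        also have "\<dots> < 2 ^ m'" using m0 m' by blast
        finally show False .
      qed
      then have "real m * \<delta> \<le> real m0 * \<delta>" using assms(2) by (intro mult_right_mono) auto
      then show ?thesis using R[OF m] by simp
    qed
  qed
qed

text \<open>
  Quasiconvexity without geodesics: a point \<open>v\<close> with \<open>gromov_product v x y = 0\<close> is a point of some
  geodesic from \<open>x\<close> to \<open>y\<close>, and the Gromov product on the right also covers points that are only
  near a geodesic.
\<close>

definition (in Metric_space) interval_quasiconvex :: "real \<Rightarrow> 'a set \<Rightarrow> bool" where
  "interval_quasiconvex k Z \<longleftrightarrow> Z \<subseteq> M \<and>
     (\<forall>x\<in>Z. \<forall>y\<in>Z. \<forall>v\<in>M. \<exists>z\<in>Z. d v z \<le> gromov_product v x y + k)"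

text \<open>
  The last two assumptions are what a word metric offers in place of geodesics: distances are
  natural numbers, and between two points there is a point at each integer distance.
\<close>

locale gromov_space = Metric_space M d for M :: "'a set" and d :: "'a \<Rightarrow> 'a \<Rightarrow> real" +
  fixes \<delta> :: real
  assumes delta_nonneg: "0 \<le> \<delta>"
    and hyp: "\<lbrakk>w \<in> M; x \<in> M; y \<in> M; z \<in> M\<rbrakk>
      \<Longrightarrow> min (gromov_product w x y) (gromov_product w y z) - \<delta> \<le> gromov_product w x z"
    and dist_nat: "\<lbrakk>x \<in> M; y \<in> M\<rbrakk> \<Longrightarrow> \<exists>n::nat. d x y = real n"
    and between: "\<lbrakk>x \<in> M; y \<in> M; real n \<le> d x y\<rbrakk>
      \<Longrightarrow> \<exists>u\<in>M. d x u = real n \<and> d u y = d x y - real n"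
begin

text \<open>
  Exponential divergence: halving a chain of \<open>2 ^ m\<close> steps \<open>m\<close> times costs \<open>\<delta>\<close> each time, so a chain
  that avoids the ball of radius \<open>R\<close> about \<open>v\<close> and has few steps can only join points whose Gromov
  product at \<open>v\<close> is not much below \<open>R\<close>.
\<close>

lemma chain_divergence:
  assumes P: "P \<subseteq> M" "v \<in> M" "\<And>a. a \<in> P \<Longrightarrow> R \<le> d v a" and c: "0 \<le> c"
    and chain: "((\<lambda>a b. a \<in> P \<and> b \<in> P \<and> d a b \<le> c) ^^ n) x y" "x \<in> P" "n \<le> 2 ^ m"
  shows "y \<in> P \<and> R - c - real m * \<delta> \<le> gromov_product v x y"
  using chain
proof (induction m arbitrary: n x y)
  case 0
  then consider "n = 0" | "n = 1" by force
  then show ?case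
  proof cases
    case 1
    then have "y = x" using 0 by simp
    moreover have "d x x = 0" using 0 P by auto
    moreover have "R \<le> d x v" using P(3)[of x] 0 commute[of x v] by simp
    ultimately show ?thesis using 0 c \<open>y = x\<close> by (simp add: gromov_product_def)
  next
    case 2
    then have y: "y \<in> P" "d x y \<le> c" using 0 by (auto simp: relpowp_1)
    then show ?thesis using P(3)[of x] P(3)[of y] 0 c by (auto simp: gromov_product_def commute)
  qed
next
  case (Suc m)
  let ?S = "\<lambda>a b. a \<in> P \<and> b \<in> P \<and> d a b \<le> c"
  define a b where "a = n div 2" and "b = n - n div 2"
  have n: "n = a + b" and le: "a \<le> 2 ^ m" "b \<le> 2 ^ m" using Suc.prems by (auto simp: a_def b_def)
  obtain z where z: "(?S ^^ a) x z" "(?S ^^ b) z y"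
    using Suc.prems(1) unfolding n by (auto simp: relpowp_add)
  have 1: "z \<in> P" "R - c - real m * \<delta> \<le> gromov_product v x z"
    using Suc.IH[OF z(1) Suc.prems(2) le(1)] by auto
  have 2: "y \<in> P" "R - c - real m * \<delta> \<le> gromov_product v z y"
    using Suc.IH[OF z(2) 1(1) le(2)] by auto
  show ?case using hyp[of v x z y] 1 2 P Suc.prems by (auto simp: algebra_simps subset_iff)
qed

definition nearest :: "'a set \<Rightarrow> 'a \<Rightarrow> 'a" where
  "nearest Z x = (SOME p. p \<in> Z \<and> (\<forall>z\<in>Z. d x p \<le> d x z))"

lemma nearest:
  assumes "Z \<subseteq> M" "Z \<noteq> {}" "x \<in> M"
  shows "nearest Z x \<in> Z" "z \<in> Z \<Longrightarrow> d x (nearest Z x) \<le> d x z"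
proof -
  obtain z0 where "z0 \<in> Z" using assms by blast
  from ex_has_least_nat[of "\<lambda>z. z \<in> Z", OF this, of "\<lambda>z. nat \<lfloor>d x z\<rfloor>"]
  obtain p where p: "p \<in> Z" "\<And>z. z \<in> Z \<Longrightarrow> nat \<lfloor>d x p\<rfloor> \<le> nat \<lfloor>d x z\<rfloor>" by blast
  have "d x p \<le> d x z" if z: "z \<in> Z" for z
  proof -
    obtain a b where "d x p = real a" "d x z = real b"
      using dist_nat[OF assms(3)] p(1) z assms(1) by blast
    then show ?thesis using p(2)[OF z] by simp
  qed
  then have "\<exists>p. p \<in> Z \<and> (\<forall>z\<in>Z. d x p \<le> d x z)" using p(1) by blast
  from someI_ex[OF this]
  show "nearest Z x \<in> Z" "z \<in> Z \<Longrightarrow> d x (nearest Z x) \<le> d x z"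
    unfolding nearest_def by auto
qed

lemma nearest_self: "Z \<subseteq> M \<Longrightarrow> x \<in> Z \<Longrightarrow> nearest Z x = x"
proof -
  assume Z: "Z \<subseteq> M" and x: "x \<in> Z"
  then have "nearest Z x \<in> Z" "d x (nearest Z x) \<le> d x x" using nearest[of Z x] by auto
  moreover have "d x x = 0" using Z x by auto
  ultimately have "d x (nearest Z x) = 0" using nonneg[of x "nearest Z x"] by linarith
  then show ?thesis using zero[of x "nearest Z x"] Z x \<open>nearest Z x \<in> Z\<close> by (metis subsetD)
qed

text \<open>
  A form of the Morse lemma. Let \<open>w\<close> be a point between \<open>x\<close> and \<open>y\<close> that is farthest from \<open>Z\<close>, say at
  distance \<open>R\<close>. Go back from \<open>w\<close> by \<open>2 R\<close> in both directions (or to \<open>x\<close> or \<open>y\<close>, if these come first),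
  and from there to \<open>Z\<close>, which is at most \<open>R\<close> away. The two points of \<open>Z\<close> have distance at most \<open>6 R\<close>,
  so they are joined by a chain in \<open>Z\<close> whose number of steps is linear in \<open>R\<close> and which stays
  outside the ball of radius \<open>R\<close> about \<open>w\<close>. Since \<open>w\<close> lies between the two points that were
  reached first, divergence bounds \<open>R\<close> by a logarithm of the number of steps.
\<close>

lemma chain_connected_imp_interval_quasiconvex:
  assumes Z: "Z \<subseteq> M" and c: "0 \<le> c" and C: "0 \<le> C"
    and chain: "\<And>p q. p \<in> Z \<Longrightarrow> q \<in> Z \<Longrightarrow> \<exists>n. real n \<le> C * d p q + C \<and>
        ((\<lambda>a b. a \<in> Z \<and> b \<in> Z \<and> d a b \<le> c) ^^ n) p q"
  shows "\<exists>k\<ge>0. interval_quasiconvex k Z"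
proof -
  obtain B where B: "0 \<le> B"
    "\<And>R. (\<And>m. 6 * C * R + C \<le> 2 ^ m \<Longrightarrow> R \<le> (c + 2 * \<delta>) + real m * \<delta>) \<Longrightarrow> R \<le> B"
    using linear_bound_of_log_bound[of "6 * C" \<delta> C "c + 2 * \<delta>"] C delta_nonneg by auto
  define D where "D v = d v (nearest Z v)" for v
  have on_geodesic: "D v \<le> B" if x: "x \<in> Z" and y: "y \<in> Z" and v: "v \<in> M" "d x v + d v y = d x y" for x y v
  proof -
    define I where "I = {v \<in> M. d x v + d v y = d x y}"
    have xy: "x \<in> M" "y \<in> M" "Z \<noteq> {}" using x y Z by auto
    have D_nat: "\<exists>n::nat. D u = real n" if "u \<in> M" for u
      using that nearest(1)[OF Z xy(3) that] Z dist_nat unfolding D_def by blast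
    have D_le: "D u \<le> d u z" if "u \<in> M" "z \<in> Z" for u z
      using nearest[OF Z xy(3)] that unfolding D_def by blast
    have "nat \<lfloor>D u\<rfloor> \<le> nat \<lfloor>d x y\<rfloor>" if "u \<in> I" for u
    proof (intro nat_mono floor_mono)
      show "D u \<le> d x y" using D_le[of u y] that y nonneg[of x u] unfolding I_def mem_Collect_eq by linarith
    qed
    then have "\<forall>u. u \<in> I \<longrightarrow> nat \<lfloor>D u\<rfloor> < Suc (nat \<lfloor>d x y\<rfloor>)" by (simp add: le_imp_less_Suc)
    moreover have "v \<in> I" using v by (simp add: I_def)
    ultimately obtain w where w: "w \<in> I" "\<And>u. u \<in> I \<Longrightarrow> nat \<lfloor>D u\<rfloor> \<le> nat \<lfloor>D w\<rfloor>"
      using Lattices_Big.ex_has_greatest_nat[of "\<lambda>u. u \<in> I" v "\<lambda>u. nat \<lfloor>D u\<rfloor>"] by blast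
    have wM: "w \<in> M" "d x w + d w y = d x y" using w(1) by (auto simp: I_def)
    obtain r :: nat where r: "D w = real r" using D_nat wM by blast
    have max: "D u \<le> D w" if "u \<in> I" for u
      using w(2)[OF that] D_nat[of u] r that unfolding I_def by auto
    \<comment> \<open>\<open>e'\<close> is the point at distance \<open>2 * D w\<close> from \<open>w\<close> in the direction of \<open>e\<close>, or \<open>e\<close> itself if that
      comes first, and \<open>p\<close> is a point of \<open>Z\<close> nearest to it.\<close>
    have side: "\<exists>e'\<in>M. \<exists>p\<in>Z. d e e' + d e' w = d e w \<and> d w e' \<le> 2 * D w \<and> d e' p \<le> D w
        \<and> D w \<le> gromov_product w e' p"
      if e: "e \<in> Z" and eI: "\<And>u. u \<in> M \<Longrightarrow> d e u + d u w = d e w \<Longrightarrow> u \<in> I" for e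
    proof (cases "d w e \<le> 2 * D w")
      case True
      have "e \<in> M" using e Z by blast
      moreover have "0 \<le> D w" using r by simp
      moreover have "D w \<le> gromov_product w e e"
        using D_le[OF wM(1) e] calculation by (simp add: gromov_product_def commute)
      ultimately show ?thesis using e True commute by (intro bexI[of _ e]) auto
    next
      case False
      have eM: "e \<in> M" using e Z by blast
      obtain u where u: "u \<in> M" "d w u = real (2 * r)" "d u e = d w e - real (2 * r)"
        using between[OF wM(1) eM, of "2 * r"] False r by auto
      have uI: "u \<in> I" using eI[OF u(1)] u commute by simp
      let ?p = "nearest Z u"
      have p: "?p \<in> Z" "?p \<in> M" using nearest(1)[OF Z xy(3) u(1)] Z by auto
      have "d u ?p \<le> D w" using max[OF uI] unfolding D_def .
      moreover have "D w \<le> d w ?p" using D_le[OF wM(1) p(1)] .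
      ultimately have "D w \<le> gromov_product w u ?p" "d u ?p \<le> D w"
        using u r commute by (auto simp: gromov_product_def)
      then show ?thesis using u r p commute
        by (intro bexI[of _ u] bexI[of _ ?p]) auto
    qed
    have "\<And>u. u \<in> M \<Longrightarrow> d x u + d u w = d x w \<Longrightarrow> u \<in> I"
      using wM triangle[OF _ wM(1) xy(2)] triangle[OF xy(1) _ xy(2)] unfolding I_def by force
    from side[OF x this] obtain x' p where
      x': "x' \<in> M" "p \<in> Z" "d x x' + d x' w = d x w" "d w x' \<le> 2 * D w" "d x' p \<le> D w"
        "D w \<le> gromov_product w x' p" by blast
    have "\<And>u. u \<in> M \<Longrightarrow> d y u + d u w = d y w \<Longrightarrow> u \<in> I"
      using wM triangle[OF xy(1) wM(1)] triangle[OF xy(1) _ xy(2)] commute unfolding I_def by force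
    from side[OF y this] obtain y' q where
      y': "y' \<in> M" "q \<in> Z" "d y y' + d y' w = d y w" "d w y' \<le> 2 * D w" "d y' q \<le> D w"
        "D w \<le> gromov_product w y' q" by blast
    have pq: "p \<in> M" "q \<in> M" using x' y' Z by auto
    have "d x' y' = d x' w + d w y'"
      using triangle[OF x'(1) wM(1) y'(1)] triangle[OF xy(1) x'(1) xy(2)]
        triangle[OF x'(1) y'(1) xy(2)] wM x' y' commute by smt
    then have "gromov_product w x' y' = 0" using commute by (simp add: gromov_product_def)
    moreover have "min (gromov_product w x' q) (gromov_product w q y') - \<delta> \<le> gromov_product w x' y'"
      "min (gromov_product w x' p) (gromov_product w p q) - \<delta> \<le> gromov_product w x' q"
      using hyp wM x' y' pq by auto
    moreover have "gromov_product w q y' = gromov_product w y' q"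
      by (simp add: gromov_product_def commute)
    ultimately have small: "min (D w) (gromov_product w p q) \<le> 2 * \<delta>"
      using x'(6) y'(6) delta_nonneg by linarith
    have "d p q \<le> 6 * D w"
      using triangle[OF pq(1) x'(1) pq(2)] triangle[OF x'(1) wM(1) pq(2)]
        triangle[OF wM(1) y'(1) pq(2)] x' y' commute by smt
    then have *: "C * d p q + C \<le> 6 * C * D w + C" using C mult_left_mono[of "d p q" "6 * D w" C] by simp
    obtain n where n: "real n \<le> C * d p q + C" "((\<lambda>a b. a \<in> Z \<and> b \<in> Z \<and> d a b \<le> c) ^^ n) p q"
      using chain x' y' by blast
    have "D w \<le> (c + 2 * \<delta>) + real m * \<delta>" if "6 * C * D w + C \<le> 2 ^ m" for m
    proof -
      have "real n \<le> 2 ^ m" using n(1) * that by linarith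
      then have "n \<le> 2 ^ m" by simp
      then have "D w - c - real m * \<delta> \<le> gromov_product w p q"
        using chain_divergence[OF Z wM(1) D_le[OF wM(1)] c n(2) x'(2)] by blast
      then show ?thesis using small c delta_nonneg mult_nonneg_nonneg[of "real m" \<delta>] by linarith
    qed
    then have "D w \<le> B" by (rule B(2))
    then show ?thesis using max[of v] v by (auto simp: I_def)
  qed
  have "interval_quasiconvex (B + 2 * \<delta> + 1) Z"
    unfolding interval_quasiconvex_def
  proof (intro conjI ballI Z)
    fix x y v assume xyv: "x \<in> Z" "y \<in> Z" "v \<in> M"
    then have M: "x \<in> M" "y \<in> M" "Z \<noteq> {}" using Z by auto
    define g where "g = gromov_product x v y"
    have g: "0 \<le> g" "g \<le> d x y"
      using triangle[OF xyv(3) M(1,2)] triangle[OF M(1) xyv(3) M(2)] triangle[of v y x] M xyv commute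
      unfolding g_def gromov_product_def by (auto simp: commute)
    define n where "n = nat \<lfloor>g\<rfloor>"
    have n: "real n \<le> g" "g < real n + 1" using g unfolding n_def by linarith+
    obtain u where u: "u \<in> M" "d x u = real n" "d u y = d x y - real n"
      using between[of x y n] M n g by auto
    have "gromov_product x u y = real n" "gromov_product x y u = real n"
      using u commute by (auto simp: gromov_product_def)
    then have "real n - \<delta> \<le> gromov_product x v u"
      using hyp[of x v y u] M xyv u n unfolding g_def by auto
    then have vu: "d v u \<le> gromov_product v x y + 2 * \<delta> + 1"
      using u n unfolding g_def gromov_product_def by (simp add: commute) argo
    have "d u (nearest Z u) \<le> B" using on_geodesic[OF xyv(1,2) u(1)] u unfolding D_def by simp
    moreover have "nearest Z u \<in> Z" using nearest(1)[OF Z M(3) u(1)] .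
    ultimately show "\<exists>z\<in>Z. d v z \<le> gromov_product v x y + (B + 2 * \<delta> + 1)"
      using vu triangle[OF xyv(3) u(1), of "nearest Z u"] Z by (intro bexI[of _ "nearest Z u"]) auto
  qed
  then show ?thesis using B(1) delta_nonneg by (intro exI[of _ "B + 2 * \<delta> + 1"]) auto
qed

text \<open>
  Let \<open>p\<close> be the nearest point. A geodesic from \<open>p\<close> to \<open>z\<close> runs towards \<open>x\<close> for a length of about
  \<open>gromov_product p x z\<close>, and all the while it stays near \<open>Z\<close>. If this length were large, there would
  be a point of \<open>Z\<close> closer to \<open>x\<close> than \<open>p\<close>.
\<close>

lemma gromov_product_nearest:
  assumes k: "interval_quasiconvex k Z" and x: "x \<in> M" and z: "z \<in> Z"
  shows "gromov_product (nearest Z x) x z \<le> k + 2 * \<delta> + 1"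
proof -
  have Z: "Z \<subseteq> M" "Z \<noteq> {}" using k z unfolding interval_quasiconvex_def by auto
  define p where "p = nearest Z x"
  have p: "p \<in> Z" "p \<in> M" "z \<in> M" using nearest(1)[OF Z x] Z z unfolding p_def by auto
  define g where "g = gromov_product p x z"
  have g: "0 \<le> g" "g \<le> d p z"
    using triangle[OF x p(2,3)] triangle[OF x p(3) p(2)] commute
    unfolding g_def gromov_product_def by (auto simp: commute)
  define n where "n = nat \<lfloor>g\<rfloor>"
  have n: "real n \<le> g" "g < real n + 1" using g unfolding n_def by linarith+
  obtain u where u: "u \<in> M" "d p u = real n" "d u z = d p z - real n"
    using between[of p z n] p n g by auto
  have "gromov_product p z u = real n" using u commute by (auto simp: gromov_product_def)
  then have "real n - \<delta> \<le> gromov_product p x u"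
    using hyp[of p x z u] p x u n unfolding g_def by auto
  then have xu: "d x u \<le> d x p - real n + 2 * \<delta>"
    using u unfolding gromov_product_def by (simp add: commute)
  have "gromov_product u p z = 0" using u by (simp add: gromov_product_def commute)
  then obtain z' where z': "z' \<in> Z" "d u z' \<le> k"
    using k p(1) z u(1) unfolding interval_quasiconvex_def by fastforce
  have "d x p \<le> d x z'" using nearest(2)[OF Z x z'(1)] unfolding p_def .
  also have "\<dots> \<le> d x u + d u z'" using triangle[OF x u(1)] z' Z by blast
  finally show ?thesis using xu z'(2) n unfolding g_def p_def by linarith
qed

lemma nearest_lipschitz:
  assumes k: "interval_quasiconvex k Z" and xy: "x \<in> M" "y \<in> M" and Z: "Z \<noteq> {}"
  shows "d (nearest Z x) (nearest Z y) \<le> d x y + 2 * (k + 2 * \<delta> + 1)"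
proof -
  let ?p = "nearest Z x" and ?q = "nearest Z y"
  have ZM: "Z \<subseteq> M" using k unfolding interval_quasiconvex_def by auto
  have pq: "?p \<in> Z" "?q \<in> Z" using nearest(1)[OF ZM Z] xy by auto
  then have M: "?p \<in> M" "?q \<in> M" using ZM by auto
  show ?thesis
    using gromov_product_nearest[OF k xy(1) pq(2)] gromov_product_nearest[OF k xy(2) pq(1)]
      triangle[OF xy M(2)] triangle[OF xy(2,1) M(1)] commute[of x y] commute[of ?p ?q]
    unfolding gromov_product_def by argo
qed

text \<open>
  The middle part of a geodesic between two far apart projections \<open>p\<close> and \<open>q\<close> fellow-travels every
  geodesic between the projected points \<open>x\<close> and \<open>y\<close>.
\<close>

lemma gromov_product_between_projections:
  assumes M: "x \<in> M" "y \<in> M" "p \<in> M" "q \<in> M" "u \<in> M"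
    and p: "gromov_product p x q \<le> c" and q: "gromov_product q y p \<le> c"
    and u: "d p u + d u q = d p q" "c + 3 * \<delta> < d p u" "c + 3 * \<delta> < d u q"
  shows "gromov_product u x y \<le> 2 * \<delta>"
proof -
  have end_point: "2 * \<delta> < gromov_product u a x'"
    if "a \<in> M" "b \<in> M" "x' \<in> M" "gromov_product a x' b \<le> c" "d a u + d u b = d a b" "c + 3 * \<delta> < d a u"
    for a b x'
  proof -
    have "gromov_product a u b = d a u"
      using that(5) by (simp add: gromov_product_def commute)
    then have "gromov_product a x' u \<le> c + \<delta>"
      using hyp[of a x' u b] that M delta_nonneg by simp
    moreover have "gromov_product u a x' = d a u - gromov_product a x' u"
      by (simp add: gromov_product_def commute field_simps)
    ultimately show ?thesis using that by linarith
  qed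
  have "2 * \<delta> < gromov_product u p x" using end_point[of p q x] M p u by auto
  moreover have "2 * \<delta> < gromov_product u q y"
    using end_point[of q p y] M q u by (auto simp: commute add.commute)
  moreover have "gromov_product u p q = 0" using u by (simp add: gromov_product_def commute)
  moreover have "min (gromov_product u p y) (gromov_product u y q) - \<delta> \<le> gromov_product u p q"
    "min (gromov_product u p x) (gromov_product u x y) - \<delta> \<le> gromov_product u p y"
    using hyp M by auto
  moreover have "gromov_product u y q = gromov_product u q y"
    by (simp add: gromov_product_def commute)
  ultimately show ?thesis using delta_nonneg by linarith
qed

end

section \<open>Word metrics and undistorted subgroups\<close>

context finitely_generated_group
begin

lemma word_dist_left_mult:
  assumes "z \<in> carrier G" "x \<in> carrier G" "y \<in> carrier G"
  shows "word_dist G S (z \<otimes> x) (z \<otimes> y) = word_dist G S x y"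
proof -
  have "inv (z \<otimes> x) \<otimes> (z \<otimes> y) = inv x \<otimes> y"
    using assms by (simp add: inv_mult_group m_assoc)
  then show ?thesis using assms by (simp add: word_dist_def)
qed

lemma word_dist_between:
  assumes x: "x \<in> carrier G" and y: "y \<in> carrier G" and n: "real n \<le> word_dist G S x y"
  shows "\<exists>u\<in>carrier G. word_dist G S x u = real n \<and> word_dist G S u y = word_dist G S x y - real n"
proof -
  interpret MS: Metric_space "carrier G" "word_dist G S" by (rule Metric_space_word_dist)
  obtain ws where ws: "length ws = word_length G S (inv x \<otimes> y)" "set ws \<subseteq> T" "eval_word ws = inv x \<otimes> y"
    using word_length_witness[of "inv x \<otimes> y"] x y by auto
  define a b where "a = eval_word (take n ws)" and "b = eval_word (drop n ws)"
  have sub: "set (take n ws) \<subseteq> T" "set (drop n ws) \<subseteq> T"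
    using ws(2) set_take_subset[of n ws] set_drop_subset[of n ws] by blast+
  have c: "a \<in> carrier G" "b \<in> carrier G" using sub eval_word_closed unfolding a_def b_def by auto
  have ab: "a \<otimes> b = inv x \<otimes> y"
    using eval_word_append[OF sub] ws(3) unfolding a_def b_def by simp
  have nl: "n \<le> length ws" using n x y ws(1) by (simp add: word_dist_def)
  have "word_dist G S x (x \<otimes> a) \<le> real n"
    using word_length_le[OF sub(1)] nl x c(1) unfolding a_def[symmetric] by (simp add: word_dist_def)
  moreover have "word_dist G S (x \<otimes> a) y \<le> word_dist G S x y - real n"
  proof -
    have "y = x \<otimes> a \<otimes> b" using x y c ab by (simp add: m_assoc)
    then have "inv (x \<otimes> a) \<otimes> y = b" using x c mult_inv_cancel(2)[of "x \<otimes> a" b] by simp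
    then show ?thesis
      using word_length_le[OF sub(2)] nl x y c(1) ws(1) unfolding b_def[symmetric]
      by (simp add: word_dist_def)
  qed
  moreover have "word_dist G S x y \<le> word_dist G S x (x \<otimes> a) + word_dist G S (x \<otimes> a) y"
    using MS.triangle x y c by simp
  ultimately show ?thesis using x c by (intro bexI[of _ "x \<otimes> a"]) auto
qed

lemma gromov_space_word_dist:
  assumes "Metric_space.gromov_hyperbolic (carrier G) (word_dist G S)"
  obtains \<delta> where "gromov_space (carrier G) (word_dist G S) \<delta>"
proof -
  interpret MS: Metric_space "carrier G" "word_dist G S" by (rule Metric_space_word_dist)
  obtain \<delta> where \<delta>: "0 \<le> \<delta>" "\<And>w x y z. \<lbrakk>w \<in> carrier G; x \<in> carrier G; y \<in> carrier G; z \<in> carrier G\<rbrakk> \<Longrightarrow>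
      min (MS.gromov_product w x y) (MS.gromov_product w y z) - \<delta> \<le> MS.gromov_product w x z"
    using assms unfolding MS.gromov_hyperbolic_def by blast
  show thesis
  proof (rule that, unfold_locales)
    show "\<exists>n::nat. word_dist G S x y = real n" for x y
      by (cases "x \<in> carrier G \<and> y \<in> carrier G") (auto simp: word_dist_def intro: exI[of _ 0])
  qed (use \<delta> word_dist_between in auto)
qed

lemma finite_ball: "finite {g \<in> carrier G. word_length G S g \<le> n}"
proof (rule finite_subset)
  show "{g \<in> carrier G. word_length G S g \<le> n} \<subseteq> eval_word ` {ws. set ws \<subseteq> T \<and> length ws \<le> n}"
    using word_length_witness by (smt (verit, best) image_iff mem_Collect_eq subsetI)
  have "finite T" using S by (simp add: finite_generating_set_def)
  then show "finite (eval_word ` {ws. set ws \<subseteq> T \<and> length ws \<le> n})"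
    by (intro finite_imageI finite_lists_length_le)
qed

lemma unit_chain_word:
  assumes "g \<in> carrier G" "set ws \<subseteq> T"
  shows "((\<lambda>a b. a \<in> carrier G \<and> b \<in> carrier G \<and> word_dist G S a b \<le> 1) ^^ length ws) g (g \<otimes> eval_word ws)"
  using assms
proof (induction ws arbitrary: g)
  case (Cons t ws)
  have t: "t \<in> T" "t \<in> carrier G" using Cons.prems T_carrier by auto
  have w: "eval_word ws \<in> carrier G" using Cons.prems eval_word_closed by simp
  have "word_length G S t \<le> 1" using word_length_le[of "[t]"] t by simp
  then have "word_dist G S g (g \<otimes> t) \<le> 1" using Cons.prems t by (simp add: word_dist_def)
  moreover have "g \<otimes> t \<otimes> eval_word ws = g \<otimes> eval_word (t # ws)"
    using Cons.prems t w by (simp add: m_assoc)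
  ultimately have "((\<lambda>a b. a \<in> carrier G \<and> b \<in> carrier G \<and> word_dist G S a b \<le> 1) ^^ Suc (length ws))
      g (g \<otimes> eval_word (t # ws))"
    using Cons.IH[of "g \<otimes> t"] Cons.prems t by (intro relpowp_Suc_I2[of _ g "g \<otimes> t"]) auto
  then show ?case by (simp only: length_Cons)
qed simp

lemma unit_chain:
  assumes "g \<in> carrier G" "h \<in> carrier G"
  obtains n where "real n = word_dist G S g h"
    "((\<lambda>a b. a \<in> carrier G \<and> b \<in> carrier G \<and> word_dist G S a b \<le> 1) ^^ n) g h"
proof -
  obtain ws where ws: "length ws = word_length G S (inv g \<otimes> h)" "set ws \<subseteq> T" "eval_word ws = inv g \<otimes> h"
    using word_length_witness[of "inv g \<otimes> h"] assms by auto
  show thesis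
    using that[of "length ws"] unit_chain_word[OF assms(1) ws(2)] ws(1,3) assms
    by (simp add: word_dist_def)
qed

text \<open>
  The displacement of \<open>f\<close> under a word is at most the sum of the displacements under its letters, and
  the finitely many letters have a common bound.
\<close>

lemma lipschitz_of_translations:
  fixes f :: "'a \<Rightarrow> 'b"
  assumes "Metric_space N e" and f: "f \<in> carrier G \<rightarrow> N"
    and tr: "\<And>s. s \<in> carrier G \<Longrightarrow> \<exists>C. \<forall>g\<in>carrier G. e (f g) (f (g \<otimes> s)) \<le> C"
  obtains C :: real where "0 \<le> C"
    "\<And>g h. \<lbrakk>g \<in> carrier G; h \<in> carrier G\<rbrakk> \<Longrightarrow> e (f g) (f h) \<le> C * word_dist G S g h"
proof -
  interpret N: Metric_space N e by fact
  have finT: "finite T" using S by (simp add: finite_generating_set_def)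
  have "\<forall>s\<in>T. \<exists>C. \<forall>g\<in>carrier G. e (f g) (f (g \<otimes> s)) \<le> C" using tr T_carrier by blast
  then obtain D where D: "\<And>s g. s \<in> T \<Longrightarrow> g \<in> carrier G \<Longrightarrow> e (f g) (f (g \<otimes> s)) \<le> D s"
    by metis
  define C where "C = (\<Sum>s\<in>T. \<bar>D s\<bar>)"
  have C0: "0 \<le> C" unfolding C_def by (simp add: sum_nonneg)
  have C: "e (f g) (f (g \<otimes> s)) \<le> C" if "s \<in> T" "g \<in> carrier G" for s g
  proof -
    have "\<bar>D s\<bar> \<le> C" unfolding C_def using that(1) finT by (intro member_le_sum) auto
    then show ?thesis using D[OF that] by linarith
  qed
  have word: "e (f g) (f (g \<otimes> eval_word ws)) \<le> C * real (length ws)"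
    if "g \<in> carrier G" "set ws \<subseteq> T" for g ws
    using that
  proof (induction ws arbitrary: g)
    case Nil
    then have "f g \<in> N" using f by auto
    then have "e (f g) (f g) = 0" by simp
    then show ?case using Nil by simp
  next
    case (Cons t ws)
    have t: "t \<in> T" "t \<in> carrier G" using Cons.prems T_carrier by auto
    have w: "eval_word ws \<in> carrier G" using Cons.prems eval_word_closed by simp
    have "e (f g) (f (g \<otimes> t \<otimes> eval_word ws)) \<le> e (f g) (f (g \<otimes> t)) + e (f (g \<otimes> t)) (f (g \<otimes> t \<otimes> eval_word ws))"
      using f Cons.prems t w by (intro N.triangle) (auto simp: Pi_iff)
    then show ?case
      using Cons.IH[of "g \<otimes> t"] C[OF t(1) Cons.prems(1)] Cons.prems t w
      by (simp add: m_assoc algebra_simps)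
  qed
  show thesis
  proof (rule that[OF C0])
    fix g h assume gh: "g \<in> carrier G" "h \<in> carrier G"
    obtain ws where ws: "length ws = word_length G S (inv g \<otimes> h)" "set ws \<subseteq> T" "eval_word ws = inv g \<otimes> h"
      using word_length_witness[of "inv g \<otimes> h"] gh by auto
    show "e (f g) (f h) \<le> C * word_dist G S g h"
      using word[OF gh(1) ws(2)] ws(1,3) gh by (simp add: word_dist_def)
  qed
qed

lemma hom_lipschitz:
  fixes K (structure)
  assumes "finitely_generated_group K U" and f: "f \<in> hom G K"
  obtains C :: real where "0 \<le> C"
    "\<And>g h. \<lbrakk>g \<in> carrier G; h \<in> carrier G\<rbrakk> \<Longrightarrow> word_dist K U (f g) (f h) \<le> C * word_dist G S g h"
proof -
  interpret K: finitely_generated_group K U by fact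
  have "\<exists>C. \<forall>g\<in>carrier G. word_dist K U (f g) (f (g \<otimes>\<^bsub>G\<^esub> s)) \<le> C" if s: "s \<in> carrier G" for s
  proof -
    have "word_dist K U (f g) (f (g \<otimes>\<^bsub>G\<^esub> s)) = real (word_length K U (f s))" if g: "g \<in> carrier G" for g
      using f s g by (simp add: word_dist_def hom_mult hom_in_carrier)
    then show ?thesis by (intro exI[of _ "real (word_length K U (f s))"]) simp
  qed
  then show thesis
    using lipschitz_of_translations[OF K.Metric_space_word_dist, of f] f that by (auto simp: hom_def)
qed

end

text \<open>
  A geodesic of \<open>H\<close> maps to a chain in the image with bounded steps, and its length is linear in the
  distance of its ends in \<open>K\<close>.
\<close>

lemma undistorted_image_interval_quasiconvex:
  fixes H :: "('h, 'l) monoid_scheme" and K :: "('k, 'm) monoid_scheme"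
  assumes H: "finitely_generated_group H T" and K: "finitely_generated_group K S"
    and f: "f \<in> hom H K" and hyp: "gromov_space (carrier K) (word_dist K S) \<delta>"
    and C: "\<And>g h. \<lbrakk>g \<in> carrier H; h \<in> carrier H\<rbrakk>
      \<Longrightarrow> word_dist H T g h \<le> C * word_dist K S (f g) (f h) + C" "0 \<le> C"
  shows "\<exists>k\<ge>0. Metric_space.interval_quasiconvex (carrier K) (word_dist K S) k (f ` carrier H)"
proof -
  interpret H: finitely_generated_group H T by fact
  interpret X: gromov_space "carrier K" "word_dist K S" \<delta> by fact
  obtain c where c: "0 \<le> c" "\<And>g h. \<lbrakk>g \<in> carrier H; h \<in> carrier H\<rbrakk>
      \<Longrightarrow> word_dist K S (f g) (f h) \<le> c * word_dist H T g h"
    using H.hom_lipschitz[OF K f] by blast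
  show ?thesis
  proof (rule X.chain_connected_imp_interval_quasiconvex[OF _ c(1) C(2)])
    show "f ` carrier H \<subseteq> carrier K" using f by (auto simp: hom_def)
    fix p q assume "p \<in> f ` carrier H" "q \<in> f ` carrier H"
    then obtain g h where gh: "g \<in> carrier H" "h \<in> carrier H" "p = f g" "q = f h" by blast
    obtain n where n: "real n = word_dist H T g h"
      "((\<lambda>a b. a \<in> carrier H \<and> b \<in> carrier H \<and> word_dist H T a b \<le> 1) ^^ n) g h"
      using H.unit_chain[OF gh(1,2)] by blast
    let ?r = "\<lambda>a b. a \<in> f ` carrier H \<and> b \<in> f ` carrier H \<and> word_dist K S a b \<le> c"
    have step: "?r (f a) (f b)" if "a \<in> carrier H \<and> b \<in> carrier H \<and> word_dist H T a b \<le> 1" for a b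
      using that c(2)[of a b] mult_left_mono[of "word_dist H T a b" 1 c] c(1) by auto
    have "(?r ^^ m) (f a) (f b)"
      if "((\<lambda>a b. a \<in> carrier H \<and> b \<in> carrier H \<and> word_dist H T a b \<le> 1) ^^ m) a b" for m a b
      using that
    proof (induction m arbitrary: b)
      case (Suc m)
      then obtain b' where "(?r ^^ m) (f a) (f b')" "?r (f b') (f b)" using step by (auto elim!: relpowp_Suc_E)
      then show ?case by (rule relpowp_Suc_I)
    qed simp
    then show "\<exists>n. real n \<le> C * word_dist K S p q + C \<and> (?r ^^ n) p q"
      using n C(1)[OF gh(1,2)] unfolding gh(3,4) by (intro exI[of _ n]) (auto simp only:)
  qed
qed

section \<open>Projection to a malnormal quasiconvex subgroup\<close>

lemma malnormal_conjugate:
  fixes K (structure)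
  assumes "group K" "malnormal Z K" "x \<in> carrier K - Z" "z \<in> Z" "x \<otimes> z \<otimes> inv x \<in> Z"
  shows "x \<otimes> z \<otimes> inv x = \<one>"
proof -
  have "x \<otimes> z \<otimes> inv x \<in> (x <# Z #> inv x)"
    using assms(4) by (auto simp: l_coset_def r_coset_def)
  then show ?thesis using assms by (auto simp: malnormal_def)
qed

text \<open>
  The projection of a coset \<open>x Z \<noteq> Z\<close> to \<open>Z\<close> has bounded diameter. If the projections \<open>p\<close> and \<open>q\<close> of \<open>x\<close>
  and \<open>x z\<close> are far apart, then the geodesic from \<open>p\<close> to \<open>q\<close> stays, away from its ends, near both \<open>Z\<close>
  and \<open>x Z\<close>. So there are many well separated \<open>a j\<close> in \<open>Z\<close> with a \<open>b j\<close> in \<open>Z\<close> for which the element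
  \<open>inv (a j) \<otimes> (x \<otimes> b j)\<close> is short. There are only finitely many short elements, so two of these
  coincide, and then \<open>x\<close> conjugates a nontrivial element of \<open>Z\<close> into \<open>Z\<close>.
\<close>

lemma malnormal_projection_bounded:
  fixes K (structure)
  assumes K: "finitely_generated_group K S" and X: "gromov_space (carrier K) (word_dist K S) \<delta>"
    and mal: "malnormal Z K"
    and k: "Metric_space.interval_quasiconvex (carrier K) (word_dist K S) k Z" "0 \<le> k"
  defines "\<pi> \<equiv> gromov_space.nearest (word_dist K S) Z"
  shows "\<exists>D. \<forall>x\<in>carrier K - Z. \<forall>z\<in>Z. word_dist K S (\<pi> x) (\<pi> (x \<otimes> z)) \<le> D"
proof -
  interpret K: finitely_generated_group K S by fact
  interpret X: gromov_space "carrier K" "word_dist K S" \<delta> by fact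
  let ?d = "word_dist K S"
  have sub: "subgroup Z K" using mal by (simp add: malnormal_def)
  interpret Z: subgroup Z K by fact
  have Z: "Z \<subseteq> carrier K" "Z \<noteq> {}" using Z.subset Z.one_closed by blast+
  \<comment> \<open>On a geodesic of points \<open>u\<close> from \<open>p\<close> to \<open>q\<close>, those at least \<open>l\<close> from both ends lie within
    \<open>r\<close> of \<open>Z\<close> and of \<open>x Z\<close>. Sampling them at spacing \<open>s > 2 * r\<close> keeps the nearby points of \<open>Z\<close> distinct,
    and \<open>N\<close> counts the values that the connecting elements can take.\<close>
  define r where "r = 2 * \<delta> + k"
  define s where "s = nat \<lceil>2 * r\<rceil> + 1"
  define c where "c = k + 2 * \<delta> + 1"
  define l where "l = nat \<lceil>c + 3 * \<delta>\<rceil> + 1"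
  have nn: "0 \<le> r" "0 \<le> c" using k(2) X.delta_nonneg by (auto simp: r_def c_def)
  have s: "2 * r < real s" unfolding s_def by linarith
  have l: "c + 3 * \<delta> < real l" unfolding l_def by linarith
  define N where "N = card {g \<in> carrier K. word_length K S g \<le> s}"
  have "?d (\<pi> x) (\<pi> (x \<otimes> z)) \<le> real (2 * l + s * N)" if x: "x \<in> carrier K - Z" and z: "z \<in> Z" for x z
  proof (rule ccontr)
    define p q where "p = \<pi> x" and "q = \<pi> (x \<otimes> z)"
    assume "\<not> ?thesis"
    then have far: "real (2 * l + s * N) < ?d p q" by (simp add: p_def q_def)
    have xM: "x \<in> carrier K" "x \<otimes> z \<in> carrier K" using x z Z by auto
    have pq: "p \<in> Z" "q \<in> Z" unfolding p_def q_def \<pi>_def using X.nearest(1)[OF Z] xM by auto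
    then have pqM: "p \<in> carrier K" "q \<in> carrier K" using Z by auto
    have gp: "X.gromov_product p x q \<le> c" "X.gromov_product q (x \<otimes> z) p \<le> c"
      using X.gromov_product_nearest[OF k(1)] xM pq unfolding p_def q_def \<pi>_def c_def by auto
    have "\<exists>u a b. u \<in> carrier K \<and> a \<in> Z \<and> b \<in> Z \<and> ?d p u = real (l + s * j) \<and> ?d u a \<le> r \<and> ?d u (x \<otimes> b) \<le> r"
      if j: "j \<le> N" for j
    proof -
      have "s * j \<le> s * N" using j by simp
      then have "real (l + s * j) + real l \<le> real (2 * l + s * N)" by linarith
      then have jd: "real (l + s * j) + real l < ?d p q" using far by linarith
      obtain u where u: "u \<in> carrier K" "?d p u = real (l + s * j)" "?d u q = ?d p q - real (l + s * j)"
        using X.between[OF pqM, of "l + s * j"] jd by auto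
      have "X.gromov_product u p q = 0" using u by (simp add: X.gromov_product_def X.commute)
      then obtain a where a: "a \<in> Z" "?d u a \<le> k"
        using k(1) pq u(1) unfolding X.interval_quasiconvex_def by fastforce
      have "X.gromov_product u x (x \<otimes> z) \<le> 2 * \<delta>"
      proof (rule X.gromov_product_between_projections[OF xM pqM u(1) gp])
        show "c + 3 * \<delta> < ?d p u" using l u(2) of_nat_mono[of l "l + s * j", where 'a = real] by linarith
        show "c + 3 * \<delta> < ?d u q" using l u(3) jd by linarith
      qed (use u in simp)
      moreover have "X.gromov_product u x (x \<otimes> z) = X.gromov_product (inv x \<otimes> u) \<one> z"
      proof -
        have zM: "z \<in> carrier K" using z Z by blast
        have "?d x u = ?d \<one> (inv x \<otimes> u)"
          using K.word_dist_left_mult[of x \<one> "inv x \<otimes> u"] u xM by simp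
        moreover have "?d (x \<otimes> z) u = ?d z (inv x \<otimes> u)"
          using K.word_dist_left_mult[of x z "inv x \<otimes> u"] u xM zM by simp
        moreover have "?d x (x \<otimes> z) = ?d \<one> z"
          using K.word_dist_left_mult[of x \<one> z] xM zM by simp
        ultimately show ?thesis by (simp add: X.gromov_product_def)
      qed
      ultimately have small: "X.gromov_product (inv x \<otimes> u) \<one> z \<le> 2 * \<delta>" by simp
      obtain b where b: "b \<in> Z" "?d (inv x \<otimes> u) b \<le> X.gromov_product (inv x \<otimes> u) \<one> z + k"
        using k(1) z Z.one_closed K.m_closed[OF K.inv_closed[OF xM(1)] u(1)]
        unfolding X.interval_quasiconvex_def by blast
      moreover have "?d (inv x \<otimes> u) b = ?d u (x \<otimes> b)"
        using K.word_dist_left_mult[of x "inv x \<otimes> u" b] u xM b(1) Z by auto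
      ultimately have "?d u (x \<otimes> b) \<le> r" using small unfolding r_def by linarith
      moreover have "?d u a \<le> r" using a(2) X.delta_nonneg by (simp add: r_def)
      ultimately show ?thesis using u a(1) b(1) by blast
    qed
    then obtain u a b where uab: "\<And>j. j \<le> N \<Longrightarrow> u j \<in> carrier K \<and> a j \<in> Z \<and> b j \<in> Z \<and>
        ?d p (u j) = real (l + s * j) \<and> ?d (u j) (a j) \<le> r \<and> ?d (u j) (x \<otimes> b j) \<le> r"
      by metis
    then have M: "u j \<in> carrier K" "a j \<in> carrier K" "b j \<in> carrier K" if "j \<le> N" for j
      using that Z by auto
    define g where "g j = inv (a j) \<otimes> (x \<otimes> b j)" for j
    have "g ` {..N} \<subseteq> {g \<in> carrier K. word_length K S g \<le> s}"
    proof (rule image_subsetI)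
      fix j assume "j \<in> {..N}"
      then have j: "j \<le> N" by simp
      have "?d (a j) (x \<otimes> b j) \<le> ?d (a j) (u j) + ?d (u j) (x \<otimes> b j)"
        using M[OF j] xM by (intro X.triangle) auto
      also have "\<dots> \<le> 2 * r" using uab[OF j] X.commute[of "a j" "u j"] by simp
      finally have "?d (a j) (x \<otimes> b j) \<le> real s" using s by simp
      then show "g j \<in> {g \<in> carrier K. word_length K S g \<le> s}"
        using M[OF j] xM by (simp add: word_dist_def g_def)
    qed
    then have "card (g ` {..N}) \<le> N" unfolding N_def by (rule card_mono[OF K.finite_ball])
    then have "\<not> inj_on g {..N}" using card_image[of g "{..N}"] by auto
    then obtain i j where "i \<le> N" "j \<le> N" "i \<noteq> j" "g i = g j" by (auto simp: inj_on_def)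
    then obtain i j where ij: "i \<le> N" "j \<le> N" "i < j" "g i = g j"
      by (metis linorder_neqE_nat)
    have "a i \<noteq> a j"
    proof
      assume eq: "a i = a j"
      have "?d (u i) (u j) \<le> ?d (u i) (a i) + ?d (a j) (u j)"
        using X.triangle[of "u i" "a i" "u j"] M ij eq by simp
      also have "\<dots> \<le> 2 * r" using uab[OF ij(1)] uab[OF ij(2)] X.commute[of "a j" "u j"] by simp
      also have "\<dots> < real s" by (rule s)
      finally have "?d p (u j) < ?d p (u i) + real s"
        using X.triangle[of p "u i" "u j"] M ij pqM by fastforce
      then have "real (l + s * j) < real (l + s * i + s)" using uab[OF ij(1)] uab[OF ij(2)] by simp
      then have "l + s * j < l + s * i + s" by (simp only: of_nat_less_iff)
      then have "s * j < s * Suc i" by simp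
      then show False using ij(3) by (metis Suc_leI mult_le_mono2 not_le)
    qed
    moreover have "a i = a j"
    proof -
      let ?w = "b j \<otimes> inv (b i)"
      have w: "?w \<in> Z" using uab ij by auto
      have "inv (a i) \<otimes> (x \<otimes> b i) = inv (a j) \<otimes> (x \<otimes> b j)" using ij(4) by (simp add: g_def)
      then have "a j \<otimes> (inv (a i) \<otimes> (x \<otimes> b i)) = x \<otimes> b j" using M ij xM by simp
      then have "(a j \<otimes> inv (a i)) \<otimes> (x \<otimes> b i) = x \<otimes> b j" using M ij xM by (simp add: K.m_assoc)
      then have "a j \<otimes> inv (a i) = x \<otimes> b j \<otimes> inv (x \<otimes> b i)"
        using M ij xM by (metis K.inv_closed K.inv_solve_right K.m_closed)
      also have "\<dots> = x \<otimes> ?w \<otimes> inv x"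
        using M ij xM by (simp add: K.inv_mult_group K.m_assoc)
      finally have eq: "a j \<otimes> inv (a i) = x \<otimes> ?w \<otimes> inv x" .
      have "a j \<otimes> inv (a i) \<in> Z" using uab ij by auto
      then have "a j \<otimes> inv (a i) = \<one>"
        using malnormal_conjugate[OF K.is_group mal x w] unfolding eq by blast
      then show ?thesis using M ij by (metis K.inv_closed K.inv_equality K.inv_inv)
    qed
    ultimately show False by blast
  qed
  then show ?thesis by blast
qed

definition coset_rep :: "('k, 'm) monoid_scheme \<Rightarrow> 'k set \<Rightarrow> 'k \<Rightarrow> 'k" where
  "coset_rep K Z x = (SOME y. y \<in> x <#\<^bsub>K\<^esub> Z)"

context group
begin

lemma coset_rep_mem:
  assumes "subgroup Z G" "x \<in> carrier G"
  obtains z where "z \<in> Z" "coset_rep G Z x = x \<otimes> z"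
proof -
  have "x \<otimes> \<one> \<in> x <# Z" using subgroup.one_closed[OF assms(1)] unfolding l_coset_def by blast
  then have "coset_rep G Z x \<in> x <# Z" unfolding coset_rep_def by (rule someI)
  then show thesis using that by (auto simp: l_coset_def)
qed

lemma coset_rep_mult:
  assumes "subgroup Z G" "x \<in> carrier G" "z \<in> Z"
  shows "coset_rep G Z (x \<otimes> z) = coset_rep G Z x"
proof -
  have "Z \<subseteq> carrier G" by (rule subgroup.subset[OF assms(1)])
  then have "x \<otimes> z <# Z = x <# Z"
    using lcos_m_assoc[of Z x z] coset_join3[of z Z] assms by auto
  then show ?thesis by (simp add: coset_rep_def)
qed

lemma mult_not_mem_subgroup:
  assumes "subgroup Z G" "x \<in> carrier G - Z" "z \<in> Z"
  shows "x \<otimes> z \<notin> Z"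
proof
  assume "x \<otimes> z \<in> Z"
  then have "x \<otimes> z \<otimes> inv z \<in> Z"
    using assms subgroup.m_closed[OF assms(1)] subgroup.m_inv_closed[OF assms(1)] by blast
  moreover have "z \<in> carrier G" using subgroup.subset[OF assms(1)] assms(3) by blast
  ultimately show False using assms by (simp add: m_assoc)
qed

end

text \<open>
  The nearest point projection to the subgroup, altered by a bounded amount so that it becomes
  constant on every other coset. This is the only consequence of malnormality and of the
  hyperbolicity of \<open>K\<close> that the amalgam gets to see.
\<close>

theorem malnormal_coarse_retraction:
  fixes H :: "('h, 'l) monoid_scheme" and K :: "('k, 'm) monoid_scheme" (structure)
  assumes H: "finitely_generated_group H T" and K: "finitely_generated_group K S"
    and f: "f \<in> mon H K" and hyp: "gromov_space (carrier K) (word_dist K S) \<delta>"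
    and C: "\<And>g h. \<lbrakk>g \<in> carrier H; h \<in> carrier H\<rbrakk>
      \<Longrightarrow> word_dist H T g h \<le> C * word_dist K S (f g) (f h) + C" "0 \<le> C"
    and mal: "malnormal (f ` carrier H) K"
  obtains q where "q \<in> carrier K \<rightarrow> carrier H"
    "\<And>h. h \<in> carrier H \<Longrightarrow> q (f h) = h"
    "\<And>x h. x \<in> carrier K - f ` carrier H \<Longrightarrow> h \<in> carrier H \<Longrightarrow> q (x \<otimes> f h) = q x"
    "\<And>k. k \<in> carrier K \<Longrightarrow> \<exists>D. \<forall>x\<in>carrier K. word_dist H T (q x) (q (x \<otimes> k)) \<le> D"
proof -
  interpret H: finitely_generated_group H T by fact
  interpret K: finitely_generated_group K S by fact
  interpret X: gromov_space "carrier K" "word_dist K S" \<delta> by fact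
  let ?d = "word_dist K S"
  define Z where "Z = f ` carrier H"
  have f_hom: "f \<in> hom H K" and f_inj: "inj_on f (carrier H)" using f by (auto simp: mon_def)
  have sub: "subgroup Z K" and mal: "malnormal Z K"
    using mal by (auto simp: malnormal_def Z_def)
  interpret Z: subgroup Z K by fact
  have Z: "Z \<subseteq> carrier K" "Z \<noteq> {}" using Z.subset Z.one_closed by blast+
  obtain k where k: "0 \<le> k" "X.interval_quasiconvex k Z"
    using undistorted_image_interval_quasiconvex[OF H K f_hom hyp C] unfolding Z_def by blast
  obtain D where D: "\<And>x z. x \<in> carrier K - Z \<Longrightarrow> z \<in> Z \<Longrightarrow> ?d (X.nearest Z x) (X.nearest Z (x \<otimes> z)) \<le> D"
    using malnormal_projection_bounded[OF K hyp mal k(2,1)] by blast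
  define rep where "rep = coset_rep K Z"
  \<comment> \<open>Projecting one representative of each coset makes \<open>p\<close> constant on the cosets other than \<open>Z\<close>.\<close>
  define p where "p x = (if x \<in> Z then x else X.nearest Z (rep x))" for x
  have pZ: "p x \<in> Z" if x: "x \<in> carrier K" for x
  proof -
    obtain z where "z \<in> Z" "rep x = x \<otimes> z" using K.coset_rep_mem[OF sub x] unfolding rep_def by blast
    then have "rep x \<in> carrier K" using x Z by auto
    from X.nearest(1)[OF Z this] show ?thesis by (simp add: p_def)
  qed
  define B where "B = \<bar>D\<bar>"
  have p_near: "?d (X.nearest Z x) (p x) \<le> B" if x: "x \<in> carrier K" for x
  proof (cases "x \<in> Z")
    case True
    then have "X.nearest Z x = x" "p x = x" using X.nearest_self[OF Z(1)] by (auto simp: p_def)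
    moreover have "?d x x = 0" using x by simp
    ultimately show ?thesis by (simp add: B_def)
  next
    case False
    obtain z where z: "z \<in> Z" "rep x = x \<otimes> z" using K.coset_rep_mem[OF sub x] unfolding rep_def by blast
    then have "?d (X.nearest Z x) (p x) \<le> D" using False D[of x z] x by (simp add: p_def)
    then show ?thesis by (simp add: B_def)
  qed
  have pM: "p x \<in> carrier K" "X.nearest Z x \<in> carrier K" if "x \<in> carrier K" for x
    using pZ[OF that] X.nearest(1)[OF Z that] Z by auto
  have p_lip: "?d (p x) (p y) \<le> ?d x y + (2 * (k + 2 * \<delta> + 1) + 2 * B)"
    if xy: "x \<in> carrier K" "y \<in> carrier K" for x y
    using X.nearest_lipschitz[OF k(2) xy Z(2)] p_near[OF xy(1)] p_near[OF xy(2)]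
      X.triangle[OF pM(1)[OF xy(1)] pM(2)[OF xy(1)] pM(1)[OF xy(2)]]
      X.triangle[OF pM(2)[OF xy(1)] pM(2)[OF xy(2)] pM(1)[OF xy(2)]]
      X.commute[of "p x" "X.nearest Z x"] by linarith
  define q where "q x = inv_into (carrier H) f (p x)" for x
  have q: "q x \<in> carrier H" "f (q x) = p x" if "x \<in> carrier K" for x
    using pZ[OF that] by (auto simp: q_def Z_def inv_into_into f_inv_into_f)
  show thesis
  proof (rule that)
    show "q \<in> carrier K \<rightarrow> carrier H" using q by auto
    show "q (f h) = h" if "h \<in> carrier H" for h
      using that f_inj by (auto simp: q_def p_def Z_def)
    show "q (x \<otimes> f h) = q x" if x: "x \<in> carrier K - f ` carrier H" and h: "h \<in> carrier H" for x h
    proof -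
      have fh: "f h \<in> Z" "f h \<in> carrier K" using h Z by (auto simp: Z_def)
      have "x \<otimes> f h \<notin> Z"
        using K.mult_not_mem_subgroup[OF sub _ fh(1)] x by (simp add: Z_def)
      then show ?thesis using x fh K.coset_rep_mult[OF sub, of x "f h"] by (auto simp: q_def p_def rep_def Z_def)
    qed
    show "\<exists>D. \<forall>x\<in>carrier K. word_dist H T (q x) (q (x \<otimes> g)) \<le> D" if g: "g \<in> carrier K" for g
    proof -
      let ?E = "real (word_length K S g) + (2 * (k + 2 * \<delta> + 1) + 2 * B)"
      have "word_dist H T (q x) (q (x \<otimes> g)) \<le> C * ?E + C" if x: "x \<in> carrier K" for x
      proof -
        have "?d x (x \<otimes> g) = real (word_length K S g)" using x g by (simp add: word_dist_def)
        then have "?d (p x) (p (x \<otimes> g)) \<le> ?E" using p_lip[of x "x \<otimes> g"] x g by simp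
        then have "C * ?d (f (q x)) (f (q (x \<otimes> g))) + C \<le> C * ?E + C"
          using C(2) q x g by (auto intro: mult_left_mono)
        then show ?thesis using C(1)[of "q x" "q (x \<otimes> g)"] q x g by fastforce
      qed
      then show ?thesis by blast
    qed
  qed
qed

section \<open>Reduced words of an amalgam and their collapse to one factor\<close>

definition transversal :: "('k, 'm) monoid_scheme \<Rightarrow> 'k set \<Rightarrow> 'k set" where
  "transversal K Z = {c \<in> carrier K - Z. coset_rep K Z c = c}"

definition right_action :: "('k, 'm) monoid_scheme \<Rightarrow> 's set \<Rightarrow> ('k \<Rightarrow> 's \<Rightarrow> 's) \<Rightarrow> bool" where
  "right_action K X \<alpha> \<longleftrightarrow> (\<forall>k\<in>carrier K. \<forall>s\<in>X. \<alpha> k s \<in> X) \<and> (\<forall>s\<in>X. \<alpha> \<one>\<^bsub>K\<^esub> s = s) \<and>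
     (\<forall>k\<in>carrier K. \<forall>k'\<in>carrier K. \<forall>s\<in>X. \<alpha> (k \<otimes>\<^bsub>K\<^esub> k') s = \<alpha> k' (\<alpha> k s))"

text \<open>
  A reduced word \<open>c\<^sub>1 \<dots> c\<^sub>n h\<close> in an amalgam, with coset representatives \<open>c\<^sub>1, \<dots>, c\<^sub>n\<close> that alternate
  between the factors and \<open>h \<in> H\<close>, is stored as the pair of \<open>h\<close> and the stack
  \<open>[c\<^sub>n, \<dots>, c\<^sub>1]\<close>; the top of the stack is where multiplication from the right takes place.
  The locale describes what one factor \<open>K\<close> sees of such stacks; \<open>emb\<close> marks its entries.
\<close>

locale stack_side = H: group H + K: group K
  for H :: "('h, 'l) monoid_scheme" and K :: "('k, 'm) monoid_scheme" (structure) +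
  fixes \<iota> :: "'h \<Rightarrow> 'k" and emb :: "'k \<Rightarrow> 'c" and L :: "'c list set"
  assumes mon: "\<iota> \<in> mon H K" and emb: "inj emb"
    and L_Cons: "emb c # t \<in> L \<longleftrightarrow>
      c \<in> transversal K (\<iota> ` carrier H) \<and> t \<in> L \<and> (\<forall>c' t'. t \<noteq> emb c' # t')"
begin

abbreviation "Z \<equiv> \<iota> ` carrier H"
abbreviation "\<kappa> \<equiv> inv_into (carrier H) \<iota>"
abbreviation "rep \<equiv> coset_rep K Z"

abbreviation "states \<equiv> carrier H \<times> L"

text \<open>
  A state amounts to an element of \<open>K\<close> on top of a stack whose own top does not belong to \<open>K\<close>. The
  maps \<open>unload\<close> and \<open>load\<close> are the two directions of this bijection, and transporting the right
  multiplication of \<open>K\<close> along it makes \<open>K\<close> act on the states.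
\<close>

definition bottoms :: "'c list set" where
  "bottoms = {t \<in> L. \<forall>c t'. t \<noteq> emb c # t'}"

definition unload :: "'h \<times> 'c list \<Rightarrow> 'k \<times> 'c list" where
  "unload s = (case snd s of
       [] \<Rightarrow> (\<iota> (fst s), [])
     | x # t \<Rightarrow> if x \<in> range emb then (the_inv emb x \<otimes> \<iota> (fst s), t) else (\<iota> (fst s), x # t))"

definition load :: "'k \<times> 'c list \<Rightarrow> 'h \<times> 'c list" where
  "load p = (if fst p \<in> Z then (\<kappa> (fst p), snd p)
     else (\<kappa> (inv (rep (fst p)) \<otimes> fst p), emb (rep (fst p)) # snd p))"

definition act :: "'k \<Rightarrow> 'h \<times> 'c list \<Rightarrow> 'h \<times> 'c list" where
  "act k s = load (fst (unload s) \<otimes> k, snd (unload s))"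

lemma hom: "\<iota> \<in> hom H K" and inj: "inj_on \<iota> (carrier H)"
  using mon by (auto simp: mon_def)

lemma iota_closed [simp]: "h \<in> carrier H \<Longrightarrow> \<iota> h \<in> carrier K"
  using hom by (auto simp: hom_def)

lemma iota_mult [simp]: "h \<in> carrier H \<Longrightarrow> h' \<in> carrier H \<Longrightarrow> \<iota> (h \<otimes>\<^bsub>H\<^esub> h') = \<iota> h \<otimes> \<iota> h'"
  using hom by (auto simp: hom_def)

lemma kappa_iota [simp]: "h \<in> carrier H \<Longrightarrow> \<kappa> (\<iota> h) = h"
  using inj by simp

lemma subgroup_Z: "subgroup Z K"
proof -
  interpret group_hom H K \<iota> by unfold_locales (rule hom)
  show ?thesis by (rule img_is_subgroup)
qed

lemma unload_Cons [simp]: "unload (h, emb c # t) = (c \<otimes> \<iota> h, t)"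
  using emb by (simp add: unload_def the_inv_f_f)

lemma unload_bottom [simp]: "t \<in> bottoms \<Longrightarrow> unload (h, t) = (\<iota> h, t)"
  by (cases t) (auto simp: unload_def bottoms_def)

lemma states_cases:
  assumes "s \<in> states"
  obtains (bottom) h t where "s = (h, t)" "h \<in> carrier H" "t \<in> bottoms"
  | (Cons) h c t where "s = (h, emb c # t)" "h \<in> carrier H" "t \<in> bottoms" "c \<in> transversal K Z"
proof (cases "snd s \<in> bottoms")
  case True
  then show thesis using bottom[of "fst s" "snd s"] assms by auto
next
  case False
  then obtain c t where c: "snd s = emb c # t" using assms by (auto simp: bottoms_def)
  then have "c \<in> transversal K Z" "t \<in> bottoms"
    using assms L_Cons[of c t] by (auto simp: bottoms_def)
  then show thesis using Cons[of "fst s" c t] c assms by (cases s) auto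
qed

lemma transversal_mult:
  assumes "c \<in> transversal K Z" "h \<in> carrier H"
  shows "c \<otimes> \<iota> h \<in> carrier K - Z" "rep (c \<otimes> \<iota> h) = c"
  using K.mult_not_mem_subgroup[OF subgroup_Z, of c "\<iota> h"] K.coset_rep_mult[OF subgroup_Z, of c "\<iota> h"]
    assms by (auto simp: transversal_def)

lemma rep_transversal:
  assumes "x \<in> carrier K - Z"
  obtains h where "h \<in> carrier H" "rep x \<in> transversal K Z" "x = rep x \<otimes> \<iota> h"
proof -
  obtain z where z: "z \<in> Z" "rep x = x \<otimes> z"
    using K.coset_rep_mem[OF subgroup_Z] assms by blast
  obtain h where h: "h \<in> carrier H" "z = \<iota> h" using z(1) by blast
  have "\<iota> (inv\<^bsub>H\<^esub> h) = inv (\<iota> h)"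
    using group_hom.hom_inv[of H K \<iota> h] hom h(1) by (simp add: group_hom_def group_hom_axioms_def)
  then have "x = rep x \<otimes> \<iota> (inv\<^bsub>H\<^esub> h)" using assms z(2) h by (simp add: K.m_assoc)
  moreover have "rep x \<in> transversal K Z"
    using K.mult_not_mem_subgroup[OF subgroup_Z assms z(1)] K.coset_rep_mult[OF subgroup_Z _ z(1), of x]
      assms z h by (simp add: transversal_def)
  ultimately show thesis using that[of "inv\<^bsub>H\<^esub> h"] h(1) by simp
qed

lemma load_iota [simp]: "h \<in> carrier H \<Longrightarrow> load (\<iota> h, t) = (h, t)"
  by (simp add: load_def)

lemma load_transversal [simp]:
  assumes "c \<in> transversal K Z" "h \<in> carrier H"
  shows "load (c \<otimes> \<iota> h, t) = (h, emb c # t)"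
proof -
  have c: "c \<in> carrier K" using assms(1) by (simp add: transversal_def)
  then have "inv c \<otimes> (c \<otimes> \<iota> h) = \<iota> h" using assms(2) by (simp add: K.m_assoc[symmetric])
  then show ?thesis using transversal_mult[OF assms] assms(2) by (simp add: load_def)
qed

lemma element_cases:
  assumes "x \<in> carrier K"
  obtains (sub) h where "x = \<iota> h" "h \<in> carrier H"
  | (coset) c h where "x = c \<otimes> \<iota> h" "h \<in> carrier H" "c \<in> transversal K Z"
proof (cases "x \<in> Z")
  case True
  then show thesis using sub by blast
next
  case False
  then obtain h where "h \<in> carrier H" "rep x \<in> transversal K Z" "x = rep x \<otimes> \<iota> h"
    using rep_transversal[of x] assms by blast
  then show thesis using coset by blast
qed

lemma unload_closed:
  assumes "s \<in> states"
  shows "fst (unload s) \<in> carrier K" "snd (unload s) \<in> bottoms"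
  using assms by (cases rule: states_cases; simp add: transversal_def)+

lemma load_closed:
  assumes "x \<in> carrier K" "t \<in> bottoms"
  shows "load (x, t) \<in> states"
  using assms(1)
proof (cases rule: element_cases)
  case sub
  then show ?thesis using assms(2) by (simp add: bottoms_def)
next
  case coset
  then show ?thesis using assms(2) by (simp add: bottoms_def L_Cons)
qed

lemma load_unload: "s \<in> states \<Longrightarrow> load (unload s) = s"
  by (cases rule: states_cases) auto

lemma unload_load:
  assumes "x \<in> carrier K" "t \<in> bottoms"
  shows "unload (load (x, t)) = (x, t)"
  using assms(1) by (cases rule: element_cases) (use assms(2) in auto)

lemma right_action_act: "right_action K states act"
  unfolding right_action_def
proof (intro conjI ballI)
  show "act k s \<in> states" if "k \<in> carrier K" "s \<in> states" for k s
    using load_closed unload_closed[OF that(2)] that(1) unfolding act_def by blast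
  show "act \<one> s = s" if "s \<in> states" for s
    using unload_closed[OF that] load_unload[OF that] by (simp add: act_def)
  show "act (k \<otimes> k') s = act k' (act k s)" if "k \<in> carrier K" "k' \<in> carrier K" "s \<in> states" for k k' s
    using unload_closed[OF that(3)] that(1,2) by (simp add: act_def unload_load K.m_assoc)
qed

text \<open>
  This formula does not mention \<open>K\<close>: the actions of the two factors agree on the amalgamated
  subgroup.
\<close>

lemma act_iota:
  assumes "h \<in> carrier H" "h' \<in> carrier H" "l \<in> L"
  shows "act (\<iota> h') (h, l) = (h \<otimes>\<^bsub>H\<^esub> h', l)"
proof -
  have "(h, l) \<in> states" using assms by simp
  then show ?thesis
  proof (cases rule: states_cases)
    case (bottom h' t')
    then show ?thesis using assms by (simp add: act_def flip: iota_mult)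
  next
    case (Cons g c t)
    then have "c \<in> carrier K" by (simp add: transversal_def)
    then show ?thesis using Cons assms by (simp add: act_def K.m_assoc flip: iota_mult)
  qed
qed

end

fun alternating :: "'a set \<Rightarrow> 'b set \<Rightarrow> ('a + 'b) list \<Rightarrow> bool" where
  "alternating A B [] \<longleftrightarrow> True"
| "alternating A B (Inl a # t) \<longleftrightarrow> a \<in> A \<and> alternating A B t \<and> (\<forall>a' t'. t \<noteq> Inl a' # t')"
| "alternating A B (Inr b # t) \<longleftrightarrow> b \<in> B \<and> alternating A B t \<and> (\<forall>b' t'. t \<noteq> Inr b' # t')"

locale amalgam_stacks = H: group H + A: group A + B: group B
  for H :: "('h, 'l) monoid_scheme" and A :: "('a, 'm) monoid_scheme"
    and B :: "('b, 'n) monoid_scheme" and i :: "'h \<Rightarrow> 'a" and j :: "'h \<Rightarrow> 'b" +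
  assumes i: "i \<in> mon H A" and j: "j \<in> mon H B"
begin

definition stacks :: "('a + 'b) list set" where
  "stacks = {l. alternating (transversal A (i ` carrier H)) (transversal B (j ` carrier H)) l}"

sublocale A: stack_side H A i Inl stacks
  by unfold_locales (auto simp: i stacks_def)

sublocale B: stack_side H B j Inr stacks
  by unfold_locales (auto simp: j stacks_def)

abbreviation "states \<equiv> carrier H \<times> stacks"

text \<open>
  With a coarse retraction \<open>q\<close> from \<open>A\<close> to \<open>H\<close> that is constant on the nontrivial cosets, a reduced word
  collapses to \<open>B\<close>: from the top downwards, an entry \<open>a\<close> from \<open>A\<close> together with all that is above it is
  replaced by \<open>q a\<close>. An entry from \<open>B\<close> is absorbed into the result only when it is the lowest one;
  any higher entry from \<open>B\<close> has an entry from \<open>A\<close> below it, which discards it.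
\<close>

fun collapse :: "('a \<Rightarrow> 'h) \<Rightarrow> 'h \<Rightarrow> ('a + 'b) list \<Rightarrow> 'b" where
  "collapse q h [] = j h"
| "collapse q h (Inl a # t) = collapse q (q a) t"
| "collapse q h (Inr b # t) = (if t = [] then b \<otimes>\<^bsub>B\<^esub> j h else collapse q h t)"

text \<open>
  Any stack other than \<open>[]\<close> and \<open>[Inr b]\<close> contains an entry from \<open>A\<close>, at which everything above it is
  forgotten.
\<close>

lemma collapse_deep:
  assumes "l \<in> stacks" "l \<noteq> []" "\<And>b. l \<noteq> [Inr b]"
  shows "collapse q h l = collapse q h' l"
proof (cases l)
  case (Cons x t)
  show ?thesis
  proof (cases x)
    case (Inr b)
    then obtain y t' where "t = y # t'" using assms(3) Cons by (cases t) auto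
    then show ?thesis using Cons Inr assms(1) by (cases y) (auto simp: stacks_def)
  qed (use Cons in simp)
qed (use assms in simp)

end

locale amalgam_stacks_retraction = amalgam_stacks H A B i j
  for H :: "('h, 'l) monoid_scheme" and A :: "('a, 'm) monoid_scheme"
    and B :: "('b, 'n) monoid_scheme" and i :: "'h \<Rightarrow> 'a" and j :: "'h \<Rightarrow> 'b" +
  fixes q :: "'a \<Rightarrow> 'h"
  assumes q_closed: "q \<in> carrier A \<rightarrow> carrier H"
    and q_iota: "h \<in> carrier H \<Longrightarrow> q (i h) = h"
    and q_coset: "x \<in> carrier A - i ` carrier H \<Longrightarrow> h \<in> carrier H \<Longrightarrow> q (x \<otimes>\<^bsub>A\<^esub> i h) = q x"
begin

lemma collapse_closed:
  assumes "h \<in> carrier H" "l \<in> stacks"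
  shows "collapse q h l \<in> carrier B"
  using assms
proof (induction l arbitrary: h)
  case (Cons x t)
  then show ?case
  proof (cases x)
    case (Inl a)
    then have "q a \<in> carrier H" "t \<in> stacks"
      using Cons.prems q_closed by (auto simp: A.L_Cons transversal_def)
    then show ?thesis using Cons.IH Inl by simp
  next
    case (Inr b)
    then have "b \<in> carrier B" "t \<in> stacks"
      using Cons.prems by (auto simp: B.L_Cons transversal_def)
    then show ?thesis using Cons Inr by simp
  qed
qed simp

lemma collapse_load_A:
  assumes x: "x \<in> carrier A"
  shows "collapse q (fst (A.load (x, t))) (snd (A.load (x, t))) = collapse q (q x) t"
  using x
proof (cases rule: A.element_cases)
  case (coset c h)
  then show ?thesis using q_coset[of c h] by (simp add: transversal_def)
qed (simp add: q_iota)

lemma collapse_load_B_Nil: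
  assumes x: "x \<in> carrier B"
  shows "collapse q (fst (B.load (x, []))) (snd (B.load (x, []))) = x"
  using x by (cases rule: B.element_cases) auto

lemma collapse_load_B_deep:
  assumes x: "x \<in> carrier B" and t: "t \<in> B.bottoms" "t \<noteq> []"
  shows "collapse q (fst (B.load (x, t))) (snd (B.load (x, t))) = collapse q h t"
  using x
proof (cases rule: B.element_cases)
  case (sub h)
  then show ?thesis using collapse_deep[of t] t by (auto simp: B.bottoms_def)
next
  case (coset c h)
  then show ?thesis using collapse_deep[of t] t by (auto simp: B.bottoms_def)
qed

definition retract :: "'h \<times> ('a + 'b) list \<Rightarrow> 'b" where
  "retract s = collapse q (fst s) (snd s)"

lemma retract_closed: "s \<in> states \<Longrightarrow> retract s \<in> carrier B"
  using collapse_closed by (auto simp: retract_def)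

lemma Nil_bottom: "[] \<in> A.bottoms" "[] \<in> B.bottoms"
proof -
  have "[] \<in> stacks" by (simp add: stacks_def)
  then show "[] \<in> A.bottoms" "[] \<in> B.bottoms" by (auto simp: A.bottoms_def B.bottoms_def)
qed

lemma retract_base:
  assumes "b \<in> carrier B"
  shows "retract (B.act b (\<one>\<^bsub>H\<^esub>, [])) = b"
proof -
  interpret group_hom H B j by unfold_locales (rule B.hom)
  show ?thesis
    using collapse_load_B_Nil[OF assms] assms B.unload_bottom[OF Nil_bottom(2), of "\<one>\<^bsub>H\<^esub>"]
    by (simp add: retract_def B.act_def)
qed

text \<open>
  Multiplication by \<open>a\<close> changes the topmost element \<open>x\<close> of \<open>A\<close> to \<open>x a\<close>, which moves \<open>q x\<close> by a bounded
  amount. Below \<open>x\<close> there is nothing, or a single entry from \<open>B\<close>, which acts on the result by a left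
  translation and hence isometrically, or enough to make the result independent of \<open>x\<close>.
\<close>

lemma retract_bounded_A:
  assumes H: "finitely_generated_group H T" and B: "finitely_generated_group B U"
    and a: "a \<in> carrier A"
    and D: "\<And>x. x \<in> carrier A \<Longrightarrow> word_dist H T (q x) (q (x \<otimes>\<^bsub>A\<^esub> a)) \<le> D"
  shows "\<exists>C. \<forall>s\<in>states. word_dist B U (retract s) (retract (A.act a s)) \<le> C"
proof -
  interpret H': finitely_generated_group H T by fact
  interpret B': finitely_generated_group B U by fact
  interpret MB: Metric_space "carrier B" "word_dist B U" by (rule B'.Metric_space_word_dist)
  obtain C where C: "0 \<le> C" "\<And>g h. \<lbrakk>g \<in> carrier H; h \<in> carrier H\<rbrakk>
      \<Longrightarrow> word_dist B U (j g) (j h) \<le> C * word_dist H T g h"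
    using H'.hom_lipschitz[OF B B.hom] by blast
  have "word_dist B U (retract s) (retract (A.act a s)) \<le> C * \<bar>D\<bar>" if s: "s \<in> states" for s
  proof -
    define x t where "x = fst (A.unload s)" and "t = snd (A.unload s)"
    have x: "x \<in> carrier A" and t: "t \<in> A.bottoms"
      using A.unload_closed[OF s] by (auto simp: x_def t_def)
    have xa: "x \<otimes>\<^bsub>A\<^esub> a \<in> carrier A" using x a by simp
    have "retract s = collapse q (q x) t"
      using collapse_load_A[OF x, of t] A.load_unload[OF s] by (simp add: retract_def x_def t_def)
    moreover have "retract (A.act a s) = collapse q (q (x \<otimes>\<^bsub>A\<^esub> a)) t"
      using collapse_load_A[OF xa, of t] by (simp add: retract_def A.act_def x_def t_def)
    moreover have "word_dist B U (collapse q (q x) t) (collapse q (q (x \<otimes>\<^bsub>A\<^esub> a)) t) \<le> C * \<bar>D\<bar>"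
    proof -
      have q: "q x \<in> carrier H" "q (x \<otimes>\<^bsub>A\<^esub> a) \<in> carrier H" using x xa q_closed by auto
      have "C * word_dist H T (q x) (q (x \<otimes>\<^bsub>A\<^esub> a)) \<le> C * \<bar>D\<bar>"
        using D[OF x] C(1) by (intro mult_left_mono) auto
      then have jq: "word_dist B U (j (q x)) (j (q (x \<otimes>\<^bsub>A\<^esub> a))) \<le> C * \<bar>D\<bar>"
        using C(2)[OF q] by linarith
      consider "t = []" | b where "t = [Inr b]" | "t \<noteq> []" "\<And>b. t \<noteq> [Inr b]" by blast
      then show ?thesis
      proof cases
        case 1
        then show ?thesis using jq by simp
      next
        case 2
        then have "b \<in> carrier B" using t by (auto simp: A.bottoms_def B.L_Cons transversal_def)
        then show ?thesis using 2 jq q B'.word_dist_left_mult by simp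
      next
        case 3
        have l: "t \<in> stacks" using t by (simp add: A.bottoms_def)
        have "collapse q (q x) t = collapse q (q (x \<otimes>\<^bsub>A\<^esub> a)) t" by (rule collapse_deep[OF l 3])
        moreover have "collapse q (q (x \<otimes>\<^bsub>A\<^esub> a)) t \<in> carrier B" by (rule collapse_closed[OF q(2) l])
        ultimately show ?thesis using C(1) by simp
      qed
    qed
    ultimately show ?thesis by simp
  qed
  then show ?thesis by blast
qed

text \<open>
  Either the topmost element of \<open>B\<close> is all there is, and the result is multiplied by \<open>b\<close>, or an entry
  from \<open>A\<close> below it makes the result independent of it.
\<close>

lemma retract_bounded_B:
  assumes B: "finitely_generated_group B U" and b: "b \<in> carrier B"
  shows "\<exists>C. \<forall>s\<in>states. word_dist B U (retract s) (retract (B.act b s)) \<le> C"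
proof -
  interpret B': finitely_generated_group B U by fact
  interpret MB: Metric_space "carrier B" "word_dist B U" by (rule B'.Metric_space_word_dist)
  have "word_dist B U (retract s) (retract (B.act b s)) \<le> real (word_length B U b)" if s: "s \<in> states" for s
  proof -
    define x t where "x = fst (B.unload s)" and "t = snd (B.unload s)"
    have x: "x \<in> carrier B" and t: "t \<in> B.bottoms"
      using B.unload_closed[OF s] by (auto simp: x_def t_def)
    have xb: "x \<otimes>\<^bsub>B\<^esub> b \<in> carrier B" using x b by simp
    have r: "retract s = collapse q (fst (B.load (x, t))) (snd (B.load (x, t)))"
      "retract (B.act b s) = collapse q (fst (B.load (x \<otimes>\<^bsub>B\<^esub> b, t))) (snd (B.load (x \<otimes>\<^bsub>B\<^esub> b, t)))"
      using B.load_unload[OF s] by (simp_all add: retract_def B.act_def x_def t_def)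
    show ?thesis
    proof (cases "t = []")
      case True
      then have "retract s = x" "retract (B.act b s) = x \<otimes>\<^bsub>B\<^esub> b"
        using r collapse_load_B_Nil[OF x] collapse_load_B_Nil[OF xb] by auto
      then show ?thesis using x b by (simp add: word_dist_def)
    next
      case False
      then have "retract s = retract (B.act b s)"
        using r collapse_load_B_deep[OF x t] collapse_load_B_deep[OF xb t] by metis
      then show ?thesis using retract_closed[OF s] by simp
    qed
  qed
  then show ?thesis by blast
qed

end

lemma (in amalgam_stacks) coarse_retraction_of_malnormal:
  assumes H: "finitely_generated_group H T" and A: "finitely_generated_group A S"
    and B: "finitely_generated_group B U"
    and hyp: "gromov_space (carrier A) (word_dist A S) \<delta>"
    and C: "\<And>g h. \<lbrakk>g \<in> carrier H; h \<in> carrier H\<rbrakk>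
      \<Longrightarrow> word_dist H T g h \<le> C * word_dist A S (i g) (i h) + C" "0 \<le> C"
    and mal: "malnormal (i ` carrier H) A"
  obtains f where "f \<in> states \<rightarrow> carrier B"
    "\<And>b. b \<in> carrier B \<Longrightarrow> f (B.act b (\<one>\<^bsub>H\<^esub>, [])) = b"
    "\<And>a. a \<in> carrier A \<Longrightarrow> \<exists>C. \<forall>s\<in>states. word_dist B U (f s) (f (A.act a s)) \<le> C"
    "\<And>b. b \<in> carrier B \<Longrightarrow> \<exists>C. \<forall>s\<in>states. word_dist B U (f s) (f (B.act b s)) \<le> C"
proof -
  obtain q where q: "q \<in> carrier A \<rightarrow> carrier H"
    "\<And>h. h \<in> carrier H \<Longrightarrow> q (i h) = h"
    "\<And>x h. x \<in> carrier A - i ` carrier H \<Longrightarrow> h \<in> carrier H \<Longrightarrow> q (x \<otimes>\<^bsub>A\<^esub> i h) = q x"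
    "\<And>k. k \<in> carrier A \<Longrightarrow> \<exists>D. \<forall>x\<in>carrier A. word_dist H T (q x) (q (x \<otimes>\<^bsub>A\<^esub> k)) \<le> D"
    using malnormal_coarse_retraction[OF H A i hyp C mal] by blast
  interpret amalgam_stacks_retraction H A B i j q
    by unfold_locales (use q in auto)
  show thesis
  proof (rule that[of retract])
    show "retract \<in> states \<rightarrow> carrier B" using retract_closed by auto
    show "retract (B.act b (\<one>\<^bsub>H\<^esub>, [])) = b" if "b \<in> carrier B" for b
      using retract_base[OF that] .
    show "\<exists>C. \<forall>s\<in>states. word_dist B U (retract s) (retract (A.act a s)) \<le> C" if "a \<in> carrier A" for a
      using q(4)[OF that] retract_bounded_A[OF H B that] by blast
    show "\<exists>C. \<forall>s\<in>states. word_dist B U (retract s) (retract (B.act b s)) \<le> C" if "b \<in> carrier B" for b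
      using retract_bounded_B[OF B that] .
  qed
qed

section \<open>Quasiconvexity of the amalgamated subgroup\<close>

context amalgam
begin

definition run :: "('a \<Rightarrow> 's \<Rightarrow> 's) \<Rightarrow> ('b \<Rightarrow> 's \<Rightarrow> 's) \<Rightarrow> 's \<Rightarrow> ('a + 'b) list \<Rightarrow> 's" where
  "run \<alpha> \<beta> = foldl (\<lambda>s x. case x of Inl a \<Rightarrow> \<alpha> a s | Inr b \<Rightarrow> \<beta> b s)"

lemma run_simps [simp]:
  "run \<alpha> \<beta> s [] = s"
  "run \<alpha> \<beta> s (Inl a # w) = run \<alpha> \<beta> (\<alpha> a s) w"
  "run \<alpha> \<beta> s (Inr b # w) = run \<alpha> \<beta> (\<beta> b s) w"
  "run \<alpha> \<beta> s (v @ w) = run \<alpha> \<beta> (run \<alpha> \<beta> s v) w"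
  by (simp_all add: run_def)

lemma run_closed:
  assumes "right_action A X \<alpha>" "right_action B X \<beta>" "w \<in> W" "s \<in> X"
  shows "run \<alpha> \<beta> s w \<in> X"
  using assms(3,4)
proof (induction w arbitrary: s)
  case (Cons x w)
  then show ?case using assms(1,2) by (cases x) (auto simp: right_action_def)
qed simp

lemma run_respects_relation:
  assumes \<alpha>: "right_action A X \<alpha>" and \<beta>: "right_action B X \<beta>"
    and agree: "\<And>h s. h \<in> carrier H \<Longrightarrow> s \<in> X \<Longrightarrow> \<alpha> (i h) s = \<beta> (j h) s"
    and "(v, w) \<in> R" "s \<in> X"
  shows "run \<alpha> \<beta> s v = run \<alpha> \<beta> s w"
  using assms(4,5)
proof induction
  case (mult_left u v x y)
  then show ?case using \<alpha> run_closed[OF \<alpha> \<beta>, of u s] by (simp add: right_action_def)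
next
  case (mult_right u v x y)
  then show ?case using \<beta> run_closed[OF \<alpha> \<beta>, of u s] by (simp add: right_action_def)
next
  case (one_left u v)
  then show ?case using \<alpha> run_closed[OF \<alpha> \<beta>, of u s] by (simp add: right_action_def)
next
  case (one_right u v)
  then show ?case using \<beta> run_closed[OF \<alpha> \<beta>, of u s] by (simp add: right_action_def)
next
  case (glue u v h)
  then show ?case using agree run_closed[OF \<alpha> \<beta>, of u s] by simp
qed auto

text \<open>
  Actions of the two factors that agree on \<open>H\<close> combine to an action of the amalgam \<open>P\<close>. If \<open>f\<close> is
  moved a bounded amount by each element of the factors, then also by each product of such elements,
  and so \<open>f\<close> is Lipschitz along the orbit of \<open>s0\<close>.
\<close>

lemma orbit_map_lipschitz:
  assumes \<alpha>: "right_action A X \<alpha>" and \<beta>: "right_action B X \<beta>"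
    and agree: "\<And>h s. h \<in> carrier H \<Longrightarrow> s \<in> X \<Longrightarrow> \<alpha> (i h) s = \<beta> (j h) s"
    and s0: "s0 \<in> X"
    and e: "Metric_space N e" and f: "f \<in> X \<rightarrow> N"
    and f\<alpha>: "\<And>a. a \<in> carrier A \<Longrightarrow> \<exists>C. \<forall>s\<in>X. e (f s) (f (\<alpha> a s)) \<le> C"
    and f\<beta>: "\<And>b. b \<in> carrier B \<Longrightarrow> \<exists>C. \<forall>s\<in>X. e (f s) (f (\<beta> b s)) \<le> C"
    and P: "finitely_generated_group P U"
  obtains C where "0 \<le> C" "\<And>u v. \<lbrakk>u \<in> W; v \<in> W\<rbrakk> \<Longrightarrow>
    e (f (run \<alpha> \<beta> s0 u)) (f (run \<alpha> \<beta> s0 v)) \<le> C * word_dist P U (R `` {u}) (R `` {v})"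
proof -
  interpret N: Metric_space N e by fact
  interpret P: finitely_generated_group P U by fact
  have letters: "\<exists>C. \<forall>s\<in>X. e (f s) (f (run \<alpha> \<beta> s w)) \<le> C" if "w \<in> W" for w
    using that
  proof (induction w)
    case Nil
    have "e (f s) (f (run \<alpha> \<beta> s [])) \<le> 0" if "s \<in> X" for s
    proof -
      have "f s \<in> N" using f that by auto
      then show ?thesis by simp
    qed
    then show ?case by blast
  next
    case (Cons x w)
    define step where "step s = run \<alpha> \<beta> s [x]" for s
    have x: "[x] \<in> W" and w: "w \<in> W" using Cons.prems by (cases x; auto)+
    have step: "step s \<in> X" if "s \<in> X" for s
      unfolding step_def using run_closed[OF \<alpha> \<beta> x that] .
    obtain C where C: "\<And>s. s \<in> X \<Longrightarrow> e (f s) (f (run \<alpha> \<beta> s w)) \<le> C" using Cons.IH[OF w] by blast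
    obtain D where D: "\<And>s. s \<in> X \<Longrightarrow> e (f s) (f (step s)) \<le> D"
      using f\<alpha> f\<beta> x unfolding step_def by (cases x) fastforce+
    have "e (f s) (f (run \<alpha> \<beta> s (x # w))) \<le> D + C" if s: "s \<in> X" for s
    proof -
      have eq: "run \<alpha> \<beta> s (x # w) = run \<alpha> \<beta> (step s) w"
        unfolding step_def by (cases x) auto
      have "e (f s) (f (run \<alpha> \<beta> (step s) w)) \<le> e (f s) (f (step s)) + e (f (step s)) (f (run \<alpha> \<beta> (step s) w))"
        using f s step[OF s] run_closed[OF \<alpha> \<beta> w step[OF s]] by (intro N.triangle) auto
      then show ?thesis using C[OF step[OF s]] D[OF s] unfolding eq by linarith
    qed
    then show ?case by blast
  qed
  \<comment> \<open>An element of \<open>P\<close> is an equivalence class of words, any of which carries \<open>s0\<close> to the same state.\<close>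
  define \<sigma> where "\<sigma> g = run \<alpha> \<beta> s0 (SOME w. w \<in> g)" for g
  have \<sigma>: "\<sigma> (R `` {w}) = run \<alpha> \<beta> s0 w" if w: "w \<in> W" for w
  proof -
    have "w \<in> R `` {w}" using w by (auto intro: amalg_rel.rel_refl)
    then have "(SOME w'. w' \<in> R `` {w}) \<in> R `` {w}" by (rule someI)
    then show ?thesis unfolding \<sigma>_def using run_respects_relation[OF \<alpha> \<beta> agree _ s0] by auto
  qed
  have \<sigma>X: "\<sigma> g \<in> X" if "g \<in> carrier P" for g
    using that \<sigma> run_closed[OF \<alpha> \<beta> _ s0] by (auto simp: amalg_carrier)
  have "\<exists>C. \<forall>x\<in>carrier P. e ((f \<circ> \<sigma>) x) ((f \<circ> \<sigma>) (x \<otimes>\<^bsub>P\<^esub> g)) \<le> C" if g: "g \<in> carrier P" for g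
  proof -
    obtain w where w: "w \<in> W" "g = R `` {w}" using g unfolding amalg_carrier by blast
    obtain C where C: "\<And>s. s \<in> X \<Longrightarrow> e (f s) (f (run \<alpha> \<beta> s w)) \<le> C" using letters[OF w(1)] by blast
    have "e (f (\<sigma> x)) (f (\<sigma> (x \<otimes>\<^bsub>P\<^esub> g))) \<le> C" if x: "x \<in> carrier P" for x
    proof -
      obtain u where u: "u \<in> W" "x = R `` {u}" using x unfolding amalg_carrier by blast
      have "\<sigma> (x \<otimes>\<^bsub>P\<^esub> g) = run \<alpha> \<beta> (\<sigma> x) w" using u w \<sigma> amalg_mult by simp
      then show ?thesis using C[OF \<sigma>X[OF x]] by simp
    qed
    then show ?thesis by (intro exI[of _ C]) simp
  qed
  moreover have "f \<circ> \<sigma> \<in> carrier P \<rightarrow> N" using f \<sigma>X by auto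
  ultimately obtain C where C: "0 \<le> C" "\<And>g h. \<lbrakk>g \<in> carrier P; h \<in> carrier P\<rbrakk>
      \<Longrightarrow> e ((f \<circ> \<sigma>) g) ((f \<circ> \<sigma>) h) \<le> C * word_dist P U g h"
    using P.lipschitz_of_translations[OF e, of "f \<circ> \<sigma>"] by blast
  show thesis
  proof (rule that[OF C(1)])
    fix u v assume uv: "u \<in> W" "v \<in> W"
    then have "R `` {u} \<in> carrier P" "R `` {v} \<in> carrier P" by (auto simp: amalg_carrier)
    from C(2)[OF this] show "e (f (run \<alpha> \<beta> s0 u)) (f (run \<alpha> \<beta> s0 v)) \<le> C * word_dist P U (R `` {u}) (R `` {v})"
      using \<sigma> uv by simp
  qed
qed

end

lemma undistorted_of_qi_embedding:
  fixes H :: "('h, 'l) monoid_scheme" and K :: "('k, 'm) monoid_scheme"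
  assumes H: "group H" and K: "finitely_generated_group K S" and qi: "qi_embedding_of_groups H K f"
  obtains T C where "finitely_generated_group H T" "0 \<le> C"
    "\<And>g h. \<lbrakk>g \<in> carrier H; h \<in> carrier H\<rbrakk> \<Longrightarrow> word_dist H T g h \<le> C * word_dist K S (f g) (f h) + C"
proof -
  interpret K: finitely_generated_group K S by fact
  obtain T U where TU: "finite_generating_set H T" "finite_generating_set K U"
    and q: "quasi_isometric_embedding (carrier H) (word_dist H T) (carrier K) (word_dist K U) f"
    using qi unfolding qi_embedding_of_groups_def by blast
  interpret H: finitely_generated_group H T using H TU by (simp add: finitely_generated_group_def finitely_generated_group_axioms_def)
  interpret KU: finitely_generated_group K U using TU by unfold_locales
  obtain B \<epsilon> where B: "0 < B" "0 \<le> \<epsilon>" and f: "f \<in> carrier H \<rightarrow> carrier K"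
    and le: "\<And>g h. \<lbrakk>g \<in> carrier H; h \<in> carrier H\<rbrakk>
      \<Longrightarrow> 1 / B * word_dist H T g h - \<epsilon> \<le> word_dist K U (f g) (f h)"
    using q unfolding quasi_isometric_embedding_def by blast
  \<comment> \<open>The word metrics of \<open>S\<close> and \<open>U\<close> are compared by the identity map.\<close>
  have "id \<in> hom K K" by (simp add: hom_def)
  then obtain D where D: "0 \<le> D" "\<And>g h. \<lbrakk>g \<in> carrier K; h \<in> carrier K\<rbrakk>
      \<Longrightarrow> word_dist K U (id g) (id h) \<le> D * word_dist K S g h"
    using K.hom_lipschitz[OF KU.finitely_generated_group_axioms] by blast
  show thesis
  proof (rule that[OF H.finitely_generated_group_axioms])
    show "0 \<le> B * D + B * \<epsilon>" using B D by simp
    fix g h assume gh: "g \<in> carrier H" "h \<in> carrier H"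
    have fgh: "f g \<in> carrier K" "f h \<in> carrier K" using f gh by auto
    let ?d = "word_dist K S (f g) (f h)"
    have "word_dist H T g h \<le> B * (word_dist K U (f g) (f h) + \<epsilon>)"
      using le[OF gh] B(1) by (simp add: field_simps)
    also have "\<dots> \<le> B * (D * ?d + \<epsilon>)" using D(2)[OF fgh] B(1) by simp
    also have "\<dots> \<le> (B * D + B * \<epsilon>) * ?d + (B * D + B * \<epsilon>)"
      using B D Metric_space.nonneg[OF K.Metric_space_word_dist, of "f g" "f h"]
      by (simp add: algebra_simps)
    finally show "word_dist H T g h \<le> (B * D + B * \<epsilon>) * ?d + (B * D + B * \<epsilon>)" .
  qed
qed

text \<open>
  Every point of the Cayley graph is within distance \<open>1\<close> of a vertex, so a point of a geodesic
  between two vertices is close to a vertex at which the Gromov product is at most \<open>1\<close>.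
\<close>

lemma (in finitely_generated_group) quasiconvex_cayley_graph:
  assumes k: "Metric_space.interval_quasiconvex (carrier G) (word_dist G S) k Z"
  shows "Metric_space.quasiconvex (cayley_graph G S) (cayley_dist G S) (vertex ` Z)"
proof -
  interpret X: Metric_space "carrier G" "word_dist G S" by (rule Metric_space_word_dist)
  interpret C: Metric_space "cayley_graph G S" "cayley_dist G S" by (rule Metric_space_cayley_dist)
  have Z: "Z \<subseteq> carrier G" using k unfolding X.interval_quasiconvex_def by blast
  have near_vertex: "\<exists>g\<in>carrier G. cayley_dist G S p (vertex g) \<le> 1" if p: "p \<in> cayley_graph G S" for p
  proof -
    obtain e where e: "e \<in> cells (carrier G) (cayley_edges G S)" "p \<in> cell_points e"
      using p by (auto simp: cayley_graph_def realization_def)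
    have cell: "finite e" "e \<noteq> {}" "e \<subseteq> carrier G" using cayley_cell[OF e(1)] by auto
    then obtain g where "g \<in> e" by blast
    then have g: "g \<in> e" "finite e" "g \<in> carrier G" using cell by auto
    have v: "vertex g \<in> cell_points e" by (rule vertex_cell[OF g(2,1)])
    have "cell_dist p (vertex g) = (\<Sum>x\<in>e. \<bar>p x - vertex g x\<bar>) / 2"
      using e(2) v g(2) by (intro cell_dist_eq) (auto simp: cell_points_def)
    also have "\<dots> \<le> (\<Sum>x\<in>e. p x + vertex g x) / 2"
      using e(2) v by (intro divide_right_mono sum_mono) (auto simp: cell_points_def abs_le_iff intro: add_increasing2 add_increasing)
    also have "\<dots> = 1" using e(2) v by (simp add: cell_points_def sum.distrib)
    finally have "cayley_dist G S p (vertex g) \<le> 1"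
      using path_dist_le[OF pl_path_single[OF e v]] by (simp add: cayley_dist_def)
    then show ?thesis using g by blast
  qed
  have "\<exists>z\<in>vertex ` Z. cayley_dist G S (c t) z \<le> k + 2"
    if x: "x \<in> Z" and y: "y \<in> Z" and c: "C.geodesic_between (vertex x) (vertex y) L c" and t: "t \<in> {0..L}"
    for x y L c t
  proof -
    have xy: "x \<in> carrier G" "y \<in> carrier G" using x y Z by auto
    have L: "c 0 = vertex x" "c L = vertex y" "0 \<in> {0..L}" "L \<in> {0..L}"
      "\<And>r s. r \<in> {0..L} \<Longrightarrow> s \<in> {0..L} \<Longrightarrow> cayley_dist G S (c r) (c s) = \<bar>r - s\<bar>"
      using c unfolding C.geodesic_between_def by auto
    have c': "c t \<in> cayley_graph G S" "c 0 = vertex x" "c L = vertex y" "0 \<le> t" "t \<le> L"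
      "cayley_dist G S (c 0) (c t) = t" "cayley_dist G S (c t) (c L) = L - t"
      "cayley_dist G S (c 0) (c L) = L"
      using c t L(1,2) L(5)[OF L(3) t] L(5)[OF t L(4)] L(5)[OF L(3,4)]
      unfolding C.geodesic_between_def by (simp_all add: image_subset_iff)
    obtain g where g: "g \<in> carrier G" "cayley_dist G S (c t) (vertex g) \<le> 1"
      using near_vertex[OF c'(1)] by blast
    have V: "vertex x \<in> cayley_graph G S" "vertex y \<in> cayley_graph G S" "vertex g \<in> cayley_graph G S"
      using vertex_cayley_graph xy g by auto
    have "word_dist G S g x \<le> t + 1"
      using C.triangle[OF V(1) c'(1) V(3)] c' g cayley_dist_vertex[OF xy(1) g(1)] X.commute[of g x] by simp
    moreover have "word_dist G S g y \<le> L - t + 1"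
      using C.triangle[OF V(3) c'(1) V(2)] c' g cayley_dist_vertex[OF g(1) xy(2)]
        C.commute[of "vertex g" "c t"] by simp
    moreover have "word_dist G S x y = L" using c' cayley_dist_vertex[OF xy] by simp
    ultimately have "X.gromov_product g x y \<le> 1"
      using X.commute[of x g] X.commute[of y g] unfolding X.gromov_product_def by argo
    moreover obtain z where z: "z \<in> Z" "word_dist G S g z \<le> X.gromov_product g x y + k"
      using k x y g(1) unfolding X.interval_quasiconvex_def by blast
    moreover have "z \<in> carrier G" using z Z by blast
    moreover have "cayley_dist G S (c t) (vertex z) \<le> cayley_dist G S (c t) (vertex g) + cayley_dist G S (vertex g) (vertex z)"
      using C.triangle c'(1) V(3) vertex_cayley_graph[OF \<open>z \<in> carrier G\<close>] by blast
    ultimately have "cayley_dist G S (c t) (vertex z) \<le> k + 2"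
      using g cayley_dist_vertex[of g z] by linarith
    then show ?thesis using z by blast
  qed
  then have "\<forall>x\<in>vertex ` Z. \<forall>y\<in>vertex ` Z. \<forall>L c. C.geodesic_between x y L c \<longrightarrow>
      (\<forall>t\<in>{0..L}. \<exists>z\<in>vertex ` Z. cayley_dist G S (c t) z \<le> k + 2)"
    by (simp only: ball_simps) blast
  moreover have "vertex ` Z \<subseteq> cayley_graph G S" using vertex_cayley_graph Z by blast
  ultimately show ?thesis unfolding C.quasiconvex_def by blast
qed

lemma hyperbolic_group_gromov_space:
  assumes "hyperbolic_group G"
  obtains S \<delta> where "finitely_generated_group G S" "gromov_space (carrier G) (word_dist G S) \<delta>"
proof -
  obtain S where S: "group G" "finite_generating_set G S"
    "Metric_space.gromov_hyperbolic (carrier G) (word_dist G S)"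
    using assms unfolding hyperbolic_group_def by blast
  then have fg: "finitely_generated_group G S"
    by (simp add: finitely_generated_group_def finitely_generated_group_axioms_def)
  then show thesis using that finitely_generated_group.gromov_space_word_dist[OF fg S(3)] by blast
qed

text \<open>
  The other factor \<open>B\<close> is undistorted in the amalgam, since the collapse is a Lipschitz map that
  inverts the inclusion of \<open>B\<close>.
\<close>

lemma (in amalgam) malnormal_left_undistorted:
  assumes i: "i \<in> mon H A" and j: "j \<in> mon H B"
    and A: "hyperbolic_group A" and B: "finitely_generated_group B U"
    and qi: "qi_embedding_of_groups H A i"
    and mal: "malnormal (i ` carrier H) A"
    and P: "finitely_generated_group P V"
  obtains C where "0 \<le> C" "\<And>b b'. \<lbrakk>b \<in> carrier B; b' \<in> carrier B\<rbrakk>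
    \<Longrightarrow> word_dist B U b b' \<le> C * word_dist P V (R `` {[Inr b]}) (R `` {[Inr b']})"
proof -
  interpret B': finitely_generated_group B U by fact
  interpret st: amalgam_stacks H A B i j by unfold_locales (use i j in auto)
  obtain S \<delta> where A: "finitely_generated_group A S" "gromov_space (carrier A) (word_dist A S) \<delta>"
    using hyperbolic_group_gromov_space[OF A] by blast
  obtain T C where T: "finitely_generated_group H T" "0 \<le> C"
    "\<And>g h. \<lbrakk>g \<in> carrier H; h \<in> carrier H\<rbrakk> \<Longrightarrow> word_dist H T g h \<le> C * word_dist A S (i g) (i h) + C"
    using undistorted_of_qi_embedding[OF H.is_group A(1) qi] by blast
  obtain f where f: "f \<in> st.states \<rightarrow> carrier B"
    "\<And>b. b \<in> carrier B \<Longrightarrow> f (st.B.act b (\<one>\<^bsub>H\<^esub>, [])) = b"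
    "\<And>a. a \<in> carrier A \<Longrightarrow> \<exists>C. \<forall>s\<in>st.states. word_dist B U (f s) (f (st.A.act a s)) \<le> C"
    "\<And>b. b \<in> carrier B \<Longrightarrow> \<exists>C. \<forall>s\<in>st.states. word_dist B U (f s) (f (st.B.act b s)) \<le> C"
    using st.coarse_retraction_of_malnormal[OF T(1) A(1) B A(2) T(3,2) mal] by blast
  have s0: "(\<one>\<^bsub>H\<^esub>, []) \<in> st.states" by (simp add: st.stacks_def)
  have agree: "st.A.act (i h) s = st.B.act (j h) s" if "h \<in> carrier H" "s \<in> st.states" for h s
    using that st.A.act_iota st.B.act_iota by (cases s) auto
  obtain C where C: "0 \<le> C" "\<And>u v. \<lbrakk>u \<in> W; v \<in> W\<rbrakk> \<Longrightarrow>
      word_dist B U (f (run st.A.act st.B.act (\<one>\<^bsub>H\<^esub>, []) u)) (f (run st.A.act st.B.act (\<one>\<^bsub>H\<^esub>, []) v))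
        \<le> C * word_dist P V (R `` {u}) (R `` {v})"
    using orbit_map_lipschitz[OF st.A.right_action_act st.B.right_action_act agree s0
        B'.Metric_space_word_dist f(1,3,4) P] by blast
  show thesis
  proof (rule that[OF C(1)])
    show "word_dist B U b b' \<le> C * word_dist P V (R `` {[Inr b]}) (R `` {[Inr b']})"
      if "b \<in> carrier B" "b' \<in> carrier B" for b b'
      using C(2)[of "[Inr b]" "[Inr b']"] that f(2) by simp
  qed
qed

text \<open>
  The stacks and their collapse are used with the roles of \<open>A\<close> and \<open>B\<close> exchanged; the words that
  represent elements of the amalgam keep their orientation.
\<close>

lemma (in amalgam) malnormal_right_undistorted:
  assumes i: "i \<in> mon H A" and j: "j \<in> mon H B"
    and B: "hyperbolic_group B" and A: "finitely_generated_group A U"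
    and qi: "qi_embedding_of_groups H B j"
    and mal: "malnormal (j ` carrier H) B"
    and P: "finitely_generated_group P V"
  obtains C where "0 \<le> C" "\<And>a a'. \<lbrakk>a \<in> carrier A; a' \<in> carrier A\<rbrakk>
    \<Longrightarrow> word_dist A U a a' \<le> C * word_dist P V (R `` {[Inl a]}) (R `` {[Inl a']})"
proof -
  interpret A': finitely_generated_group A U by fact
  interpret st: amalgam_stacks H B A j i by unfold_locales (use i j in auto)
  obtain S \<delta> where B: "finitely_generated_group B S" "gromov_space (carrier B) (word_dist B S) \<delta>"
    using hyperbolic_group_gromov_space[OF B] by blast
  obtain T C where T: "finitely_generated_group H T" "0 \<le> C"
    "\<And>g h. \<lbrakk>g \<in> carrier H; h \<in> carrier H\<rbrakk> \<Longrightarrow> word_dist H T g h \<le> C * word_dist B S (j g) (j h) + C"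
    using undistorted_of_qi_embedding[OF H.is_group B(1) qi] by blast
  obtain f where f: "f \<in> st.states \<rightarrow> carrier A"
    "\<And>a. a \<in> carrier A \<Longrightarrow> f (st.B.act a (\<one>\<^bsub>H\<^esub>, [])) = a"
    "\<And>b. b \<in> carrier B \<Longrightarrow> \<exists>C. \<forall>s\<in>st.states. word_dist A U (f s) (f (st.A.act b s)) \<le> C"
    "\<And>a. a \<in> carrier A \<Longrightarrow> \<exists>C. \<forall>s\<in>st.states. word_dist A U (f s) (f (st.B.act a s)) \<le> C"
    using st.coarse_retraction_of_malnormal[OF T(1) B(1) A B(2) T(3,2) mal] by blast
  have s0: "(\<one>\<^bsub>H\<^esub>, []) \<in> st.states" by (simp add: st.stacks_def)
  have agree: "st.B.act (i h) s = st.A.act (j h) s" if "h \<in> carrier H" "s \<in> st.states" for h s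
    using that st.A.act_iota st.B.act_iota by (cases s) auto
  obtain C where C: "0 \<le> C" "\<And>u v. \<lbrakk>u \<in> W; v \<in> W\<rbrakk> \<Longrightarrow>
      word_dist A U (f (run st.B.act st.A.act (\<one>\<^bsub>H\<^esub>, []) u)) (f (run st.B.act st.A.act (\<one>\<^bsub>H\<^esub>, []) v))
        \<le> C * word_dist P V (R `` {u}) (R `` {v})"
    using orbit_map_lipschitz[OF st.B.right_action_act st.A.right_action_act agree s0
        A'.Metric_space_word_dist f(1,4,3) P] by blast
  show thesis
  proof (rule that[OF C(1)])
    show "word_dist A U a a' \<le> C * word_dist P V (R `` {[Inl a]}) (R `` {[Inl a']})"
      if "a \<in> carrier A" "a' \<in> carrier A" for a a'
      using C(2)[of "[Inl a]" "[Inl a']"] that f(2) by simp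
  qed
qed

theorem proposition5p1:
  fixes H :: "('h, 'l) monoid_scheme"
    and G1 :: "('a, 'm) monoid_scheme"
    and G2 :: "('b, 'n) monoid_scheme"
    and i1 :: "'h \<Rightarrow> 'a"
    and i2 :: "'h \<Rightarrow> 'b"
  defines "G \<equiv> amalgamated_product H G1 G2 i1 i2"
  assumes "i1 \<in> mon H G1" and "i2 \<in> mon H G2"
    and "hyperbolic_group G"
    and "hyperbolic_group G1" and "hyperbolic_group G2" and "hyperbolic_group H"
    and "qi_embedding_of_groups H G1 i1" and "qi_embedding_of_groups H G2 i2"
    and "malnormal (i1 ` carrier H) G1 \<or> malnormal (i2 ` carrier H) G2"
  shows "quasiconvex_subgroup ((amalg_left H G1 G2 i1 i2 \<circ> i1) ` carrier H) G"
proof -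
  have groups: "group H" "group G1" "group G2" using assms by (auto simp: hyperbolic_group_def)
  have homs: "i1 \<in> hom H G1" "i2 \<in> hom H G2" using assms by (auto simp: mon_def)
  interpret amalgam H G1 G2 i1 i2
    using groups homs by (simp add: amalgam_def amalgam_axioms_def)
  obtain V \<delta> where V: "finitely_generated_group G V" "gromov_space (carrier G) (word_dist G V) \<delta>"
    using hyperbolic_group_gromov_space[OF assms(4)] by blast
  obtain S1 where S1: "finitely_generated_group G1 S1"
    using hyperbolic_group_gromov_space[OF assms(5)] by blast
  obtain S2 where S2: "finitely_generated_group G2 S2"
    using hyperbolic_group_gromov_space[OF assms(6)] by blast
  interpret G: finitely_generated_group G V by fact
  define \<phi> where "\<phi> = amalg_left H G1 G2 i1 i2 \<circ> i1"
  have hom: "\<phi> \<in> hom H G"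
    unfolding \<phi>_def G_def by (rule hom_compose[OF homs(1) amalg_left_hom])
  have \<phi>: "\<phi> h = R `` {[Inl (i1 h)]}" "\<phi> h = R `` {[Inr (i2 h)]}" if "h \<in> carrier H" for h
    using amalg_left_glue[OF that] by (simp_all add: \<phi>_def amalg_left_def)
  have closed: "i1 h \<in> carrier G1" "i2 h \<in> carrier G2" if "h \<in> carrier H" for h
    using homs that by (auto simp: hom_def)
  have compose: "a \<le> (C * D + C) * word_dist G V x y + (C * D + C)"
    if "0 \<le> C" "0 \<le> D" "a \<le> C * b + C" "b \<le> D * word_dist G V x y" for a b C D x y
  proof -
    have d: "0 \<le> word_dist G V x y" by (rule Metric_space.nonneg[OF G.Metric_space_word_dist])
    have "C * b \<le> C * (D * word_dist G V x y)" using that by (intro mult_left_mono)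
    moreover have "0 \<le> C * word_dist G V x y" "0 \<le> C * D" using that d by auto
    ultimately show ?thesis using that(3) by (simp add: algebra_simps)
  qed
  have "\<exists>T C. finitely_generated_group H T \<and> 0 \<le> C \<and> (\<forall>g\<in>carrier H. \<forall>h\<in>carrier H.
      word_dist H T g h \<le> C * word_dist G V (\<phi> g) (\<phi> h) + C)"
    using assms(10)
  proof
    assume mal: "malnormal (i1 ` carrier H) G1"
    obtain T C where T: "finitely_generated_group H T" "0 \<le> C"
      "\<And>g h. \<lbrakk>g \<in> carrier H; h \<in> carrier H\<rbrakk> \<Longrightarrow> word_dist H T g h \<le> C * word_dist G2 S2 (i2 g) (i2 h) + C"
      using undistorted_of_qi_embedding[OF groups(1) S2 assms(9)] by blast
    obtain D where D: "0 \<le> D" "\<And>b b'. \<lbrakk>b \<in> carrier G2; b' \<in> carrier G2\<rbrakk>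
        \<Longrightarrow> word_dist G2 S2 b b' \<le> D * word_dist G V (R `` {[Inr b]}) (R `` {[Inr b']})"
      using malnormal_left_undistorted[OF assms(2,3,5) S2 assms(8) mal V(1)[unfolded G_def]]
      unfolding G_def by blast
    have "word_dist H T g h \<le> (C * D + C) * word_dist G V (\<phi> g) (\<phi> h) + (C * D + C)"
      if "g \<in> carrier H" "h \<in> carrier H" for g h
      using compose[OF T(2) D(1) T(3)[OF that]] D(2) closed \<phi>(2) that by simp
    moreover have "0 \<le> C * D + C" using T(2) D(1) by simp
    ultimately show ?thesis using T(1) by blast
  next
    assume mal: "malnormal (i2 ` carrier H) G2"
    obtain T C where T: "finitely_generated_group H T" "0 \<le> C"
      "\<And>g h. \<lbrakk>g \<in> carrier H; h \<in> carrier H\<rbrakk> \<Longrightarrow> word_dist H T g h \<le> C * word_dist G1 S1 (i1 g) (i1 h) + C"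
      using undistorted_of_qi_embedding[OF groups(1) S1 assms(8)] by blast
    obtain D where D: "0 \<le> D" "\<And>a a'. \<lbrakk>a \<in> carrier G1; a' \<in> carrier G1\<rbrakk>
        \<Longrightarrow> word_dist G1 S1 a a' \<le> D * word_dist G V (R `` {[Inl a]}) (R `` {[Inl a']})"
      using malnormal_right_undistorted[OF assms(2,3,6) S1 assms(9) mal V(1)[unfolded G_def]]
      unfolding G_def by blast
    have "word_dist H T g h \<le> (C * D + C) * word_dist G V (\<phi> g) (\<phi> h) + (C * D + C)"
      if "g \<in> carrier H" "h \<in> carrier H" for g h
      using compose[OF T(2) D(1) T(3)[OF that]] D(2) closed \<phi>(1) that by simp
    moreover have "0 \<le> C * D + C" using T(2) D(1) by simp
    ultimately show ?thesis using T(1) by blast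
  qed
  then obtain T C where T: "finitely_generated_group H T" "0 \<le> C"
    "\<And>g h. \<lbrakk>g \<in> carrier H; h \<in> carrier H\<rbrakk> \<Longrightarrow> word_dist H T g h \<le> C * word_dist G V (\<phi> g) (\<phi> h) + C"
    by blast
  obtain k where "Metric_space.interval_quasiconvex (carrier G) (word_dist G V) k (\<phi> ` carrier H)"
    using undistorted_image_interval_quasiconvex[OF T(1) V(1) hom V(2) T(3,2)] by blast
  then have "Metric_space.quasiconvex (cayley_graph G V) (cayley_dist G V) (vertex ` (\<phi> ` carrier H))"
    by (rule G.quasiconvex_cayley_graph)
  moreover have "subgroup (\<phi> ` carrier H) G"
  proof -
    interpret group_hom H G \<phi> by unfold_locales (rule hom)
    show ?thesis by (rule img_is_subgroup)
  qed
  ultimately show ?thesis unfolding quasiconvex_subgroup_def \<phi>_def using G.S by blast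
qed

end
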